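(* Let $\mathcal H$ be a transactional memory that is privatization-safe opaque, i.e. for every history $H\in\mathcal H$ with $\mathsf{CDRF}(H)$ there exists $S\in\mathcal H_{\mathsf{atomic}}$ with $H\sqsubseteq S$. Let $P$ be a program with $\mathsf{TDRF}(P)$. Then $[\![P]\!](\mathcal H)\preceq[\![P]\!](\mathcal H_{\mathsf{atomic}})$, i.e. for every trace $\tau\in[\![P]\!](\mathcal H)$ there is a trace $\tau'\in[\![P]\!](\mathcal H_{\mathsf{atomic}})$ with $\tau\sim\tau'$.
   Context: **Actions and histories.** Fix threads $\mathsf{ThreadID}=\{1,\dots,N\}$, a set $\mathsf{Reg}$ of integer-valued shared registers with initial value $v_{\mathsf{init}}$, and a set of action identifiers. An interface action is a triple $(a,t,k)$ ($a$ an identifier, $t$ a thread). Requests have $k\in\{\mathsf{begintx},\mathsf{trycommit},\mathsf{write}(x,v),\mathsf{read}(x)\}$ ($x\in\mathsf{Reg}$, $v\in\mathbb Z$). Matching responses are: $\mathsf{ok}$ or $\mathsf{aborted}$ for $\mathsf{begintx}$; $\mathsf{committed}$ or $\mathsf{aborted}$ for $\mathsf{trycommit}$; $\mathsf{ret}(\bot)$ or $\mathsf{aborted}$ for $\mathsf{write}(x,v)$; $\mathsf{ret}(v)$ ($v\in\mathbb Z$) or $\mathsf{aborted}$ for $\mathsf{read}(x)$. A history is a finite sequence $H=H(1)H(2)\cdots$ of interface actions such that: identifiers are pairwise distinct; for each thread $t$ the projection $H|_t$ to actions of $t$ alternates requests and matching responses, starting with a request; for each $t$, in the projection of $H|_t$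 to $\mathsf{begintx},\mathsf{committed},\mathsf{aborted}$ actions, $\mathsf{begintx}$ alternates with $\mathsf{committed}$ or $\mathsf{aborted}$, starting with $\mathsf{begintx}$, and $\mathsf{trycommit}$ occurs only inside transactions; every read/write request of a thread all of whose earlier transactions are completed (a non-transactional request) is immediately followed by its response, which is not $\mathsf{aborted}$. A transaction in $H$ is a maximal subsequence of actions of one thread starting with $\mathsf{begintx}$ in which only the last action may be $\mathsf{committed}$ or $\mathsf{aborted}$. It is committed, aborted or commit-pending if it ends with $\mathsf{committed}$, $\mathsf{aborted}$ or $\mathsf{trycommit}$ respectively, and live otherwise. Actions outside transactions are non-transactional; a non-transactional access is a matching request/response pair of a read or write outside transactions. **TM.** A transactional memory (TM) is a prefix-closed set of histories (prefixes that are themselves histories) that is closed under appending any request action whenever the result is a history. **Atomic TM.** A history is non-interleaved if actions of one transaction do not overlap with actions of another transaction or of non-transactional accesses. A completion of a non-interleaved $H$ is a non-interleaved history $H^c$ without commit-pending transactions, having $H$ as a subsequence, whose additional actions are all $\mathsf{committed}$ or $\mathsf{aborted}$. $\mathcal H_{\mathsf{atomic}}$ is the set of non-interleaved histories $H$ having a completion $H^c$ in which every response to a $\mathsf{read}(x)$ returning a value returns the value $v$ of the last preceding $\mathsf{write}(x,v)$ not located in an aborted or live transaction different from that of the read, or $v_{\mathsf{init}}$ if there is no such write. **Correspondence.** $\alpha<_H\alpha'$ means $\alpha$ occurs before $\alpha'$ in $H$. $\alpha<_{\mathsf{po}(H)}\alpha'$ iff $\alpha<_H\alpha'$ and both are by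 the same thread; $\alpha<_{\mathsf{ef}(H)}\alpha'$ iff $\alpha<_H\alpha'$ and they are in different transactions; $\alpha<_{\mathsf{cl}(H)}\alpha'$ iff $\alpha<_H\alpha'$ and both are non-transactional. $H_1\sqsubseteq H_2$ iff there is a bijection $\theta:\{1,\dots,|H_1|\}\to\{1,\dots,|H_2|\}$ with $H_1(i)=H_2(\theta(i))$ for all $i$ and, for $i<j$, $H_1(i)<_{\mathsf{po}(H_1)\cup\mathsf{cl}(H_1)}H_1(j)$ implies $\theta(i)<\theta(j)$. **Data-race freedom.** A non-transactional request and a transactional request conflict if they are by different threads, are read or write requests on the same register, and at least one is a write. For $H\in\mathcal H_{\mathsf{atomic}}$, $\mathsf{hb}(H)=(\mathsf{po}(H)\cup\mathsf{ef}(H)\cup\mathsf{cl}(H))^+$, and $\mathsf{TDRF}(H)$ holds if every pair of conflicting actions of $H$ is ordered by $\mathsf{hb}(H)$ one way or the other. For an arbitrary history $H$, $\mathsf{CDRF}(H)$ holds if $\mathsf{TDRF}(S)$ for every $S\in\mathcal H_{\mathsf{atomic}}$ with $H\sqsubseteq S$. **Programs.** Each thread $t$ has integer-valued local variables $\mathsf{LVar}_t$ (disjoint for different threads). A program is $P=C_1\parallel\dots\parallel C_N$ with commands $C::=c\mid C;C\mid \mathtt{if}(b)\mathtt{\,then\,}C\mathtt{\,else\,}C\mid\mathtt{while}(b)\mathtt{\,do\,}C\mid l=\mathtt{atomic}\{C\}\mid l=x.\mathtt{read}()\mid x.\mathtt{write}(e)$, where $b,e$ are Boolean/integer expressions over local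 variables of the executing thread, atomic blocks are not nested, and $c$ ranges over primitive commands of thread $t$ (including assignments), with semantics $[\![c]\!]:(\mathsf{LVar}_t\to\mathbb Z)\to\mathcal P(\mathsf{LVar}_t\to\mathbb Z)$. There are also internal commands $\mathsf{assume}(b)$ (not usable in programs) with $[\![\mathsf{assume}(b)]\!](q)=\{q\}$ if $b$ holds in $q$ and $\emptyset$ otherwise. A primitive action is $(a,t,c)$. A trace is a finite sequence $\tau$ of primitive and interface actions with pairwise distinct identifiers, where primitive actions of $t$ only use commands of $t$, such that the subsequence $\mathsf{history}(\tau)$ of interface actions is a history, in $\tau|_t$ no request is immediately followed by a primitive action, and each non-transactional request is immediately followed in $\tau$ by its response. The sets $A'(C)t$ of action sequences are (identifiers arbitrary): $A'(c)t=\{(\_,t,c)\}$; $A'(C_1;C_2)t$ is concatenation; $\mathtt{if}$ yields $\mathsf{assume}(b)$ followed by a sequence of $C_1$, or $\mathsf{assume}(\neg b)$ followed by one of $C_2$; $\mathtt{while}$ yields $n\ge0$ repetitions of ($\mathsf{assume}(b)$ then a sequence of $C$), then $\mathsf{assume}(\neg b)$; $l=x.\mathtt{read}()$ yields $\mathsf{read}(x)\,\mathsf{ret}(v)\,(l:=v)$ for $v\in\mathbb Z$, or $\mathsf{read}(x)\,\mathsf{aborted}$; $x.\mathtt{write}(e)$ yields, for $v\in\mathbb Z$, $\mathsf{assume}(e=v)\,\mathsf{write}(x,v)\,\mathsf{ret}(\bot)$ or $\mathsf{assume}(e=v)\,\mathsf{write}(x,v)\,\mathsf{aborted}$; $l=\mathtt{atomic}\{C\}$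 yields $\mathsf{begintx}\,\mathsf{aborted}\,(l:=\mathsf{aborted})$, or $\mathsf{begintx}\,\mathsf{ok}\,\tau\,\mathsf{aborted}\,(l:=\mathsf{aborted})$ where $\tau\,\mathsf{aborted}$ is a prefix of a sequence in $A'(C)t$ and $\tau$ has no $\mathsf{aborted}$, or $\mathsf{begintx}\,\mathsf{ok}\,\tau\,\mathsf{trycommit}\,r\,(l:=r)$ with $\tau\in A'(C)t$ without $\mathsf{aborted}$ and $r\in\{\mathsf{committed},\mathsf{aborted}\}$ (these being distinguished values). $A(P)$ is the set of traces that are prefixes of interleavings of sequences $\tau_t\in A'(C_t)t$, $t=1,\dots,N$. A state $s$ assigns integers to all local variables. Evaluation of one action: $(\_,t,c)$ transforms the variables of $t$ by $[\![c]\!]$ and leaves other variables unchanged (giving a set of states); interface actions leave the state unchanged. $\mathsf{eval}(s,\tau)$ is $\emptyset$ if $\tau=\tau'\varphi$ for an action $\varphi$ with $\mathsf{eval}(s,\tau')=\emptyset$; otherwise it is the set of states obtained from $s$ by successively evaluating the actions of $\tau$ with all actions inside aborted transactions removed. Then $[\![P]\!](\mathcal H)=\{\tau\in A(P)\mid \exists s.\ \mathsf{eval}(s,\tau)\ne\emptyset\text{ and }\mathsf{history}(\tau)\in\mathcal H\}$. $\mathsf{TDRF}(P)$ means $\mathsf{TDRF}(\mathsf{history}(\tau))$ for all $\tau\in[\![P]\!](\mathcal H_{\mathsf{atomic}})$. **Observational equivalence.** $\tau\sim\tau'$ iff $\tau|_t=\tau'|_t$ for every thread $t$ and $\tau|_{\mathsf{nontx}}=\tau'|_{\mathsf{nontx}}$,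 where $\tau|_{\mathsf{nontx}}$ is the subsequence of actions of non-transactional accesses. For sets of traces, $\mathcal T\preceq\mathcal T'$ iff every $\tau\in\mathcal T$ has some $\tau'\in\mathcal T'$ with $\tau\sim\tau'$. *)

theory Defs
  imports Main "HOL-Library.Sublist" "HOL-Library.FuncSet" "HOL-Library.Disjoint_Sets"
begin

datatype 'r kind =
    BeginTx | TryCommit | Write 'r int | Read 'r
  | Ok | Aborted | Committed | RetUnit | RetVal int

fun request_kind :: "'r kind \<Rightarrow> bool" where
  "request_kind BeginTx = True"
| "request_kind TryCommit = True"
| "request_kind (Write x v) = True"
| "request_kind (Read x) = True"
| "request_kind _ = False"

fun access_kind :: "'r kind \<Rightarrow> bool" where
  "access_kind (Write x v) = True"
| "access_kind (Read x) = True"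
| "access_kind _ = False"

fun response_of :: "'r kind \<Rightarrow> 'r kind set" where
  "response_of BeginTx = {Ok, Aborted}"
| "response_of TryCommit = {Committed, Aborted}"
| "response_of (Write x v) = {RetUnit, Aborted}"
| "response_of (Read x) = insert Aborted (range RetVal)"
| "response_of _ = {}"

text \<open>
  Threads are the elements of a (finite) type \<open>'t\<close>, registers those of \<open>'r\<close>, identifiers
  those of \<open>'i\<close>.  Interface and primitive actions share one type, so that the
  notions below (projection, transaction, ...) apply both to histories and to traces.
\<close>

datatype ('i, 't, 'r, 'p) action =
    IAct (aid: 'i) (thr: 't) "'r kind"
  | PAct (aid: 'i) (thr: 't) 'p

fun akind :: "('i, 't, 'r, 'p) action \<Rightarrow> 'r kind option" where
  "akind (IAct a t k) = Some k"
| "akind (PAct a t c) = None"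

definition is_interface :: "('i, 't, 'r, 'p) action \<Rightarrow> bool" where
  "is_interface \<alpha> \<longleftrightarrow> akind \<alpha> \<noteq> None"

definition is_request :: "('i, 't, 'r, 'p) action \<Rightarrow> bool" where
  "is_request \<alpha> \<longleftrightarrow> (\<exists>k. akind \<alpha> = Some k \<and> request_kind k)"

definition is_access_request :: "('i, 't, 'r, 'p) action \<Rightarrow> bool" where
  "is_access_request \<alpha> \<longleftrightarrow> (\<exists>k. akind \<alpha> = Some k \<and> access_kind k)"

definition is_completing :: "('i, 't, 'r, 'p) action \<Rightarrow> bool" where
  "is_completing \<alpha> \<longleftrightarrow> akind \<alpha> \<in> {Some Committed, Some Aborted}"

definition matching :: "('i, 't, 'r, 'p) action \<Rightarrow> ('i, 't, 'r, 'p) action \<Rightarrow> bool" where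
  "matching \<alpha> \<beta> \<longleftrightarrow> thr \<alpha> = thr \<beta> \<and>
     (\<exists>k k'. akind \<alpha> = Some k \<and> akind \<beta> = Some k' \<and> k' \<in> response_of k)"

definition proj :: "'t \<Rightarrow> ('i, 't, 'r, 'p) action list \<Rightarrow> ('i, 't, 'r, 'p) action list" where
  "proj t \<tau> = filter (\<lambda>\<alpha>. thr \<alpha> = t) \<tau>"

text \<open>
  Occurrences of actions are represented by their (0-based) positions, and transactions by
  sets of positions.  A transaction is contiguous within the projection to its thread, not
  necessarily within the whole sequence.
\<close>

definition tx_segment :: "('i, 't, 'r, 'p) action list \<Rightarrow> nat set \<Rightarrow> bool" where
  "tx_segment \<tau> I \<longleftrightarrow> I \<noteq> {} \<and> I \<subseteq> {..<length \<tau>} \<and>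
     (\<exists>t. (\<forall>i\<in>I. thr (\<tau> ! i) = t) \<and>
          (\<forall>i\<in>I. \<forall>k\<in>I. \<forall>j. i < j \<and> j < k \<and> thr (\<tau> ! j) = t \<longrightarrow> j \<in> I)) \<and>
     akind (\<tau> ! Min I) = Some BeginTx \<and>
     (\<forall>i\<in>I. i \<noteq> Max I \<longrightarrow> \<not> is_completing (\<tau> ! i))"

definition transactions :: "('i, 't, 'r, 'p) action list \<Rightarrow> nat set set" where
  "transactions \<tau> = {I. tx_segment \<tau> I \<and> (\<forall>J. tx_segment \<tau> J \<and> I \<subseteq> J \<longrightarrow> J = I)}"

definition tx_committed :: "('i, 't, 'r, 'p) action list \<Rightarrow> nat set \<Rightarrow> bool" where
  "tx_committed \<tau> T \<longleftrightarrow> akind (\<tau> ! Max T) = Some Committed"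

definition tx_aborted :: "('i, 't, 'r, 'p) action list \<Rightarrow> nat set \<Rightarrow> bool" where
  "tx_aborted \<tau> T \<longleftrightarrow> akind (\<tau> ! Max T) = Some Aborted"

definition tx_commit_pending :: "('i, 't, 'r, 'p) action list \<Rightarrow> nat set \<Rightarrow> bool" where
  "tx_commit_pending \<tau> T \<longleftrightarrow> akind (\<tau> ! Max T) = Some TryCommit"

definition tx_live :: "('i, 't, 'r, 'p) action list \<Rightarrow> nat set \<Rightarrow> bool" where
  "tx_live \<tau> T \<longleftrightarrow> \<not> tx_committed \<tau> T \<and> \<not> tx_aborted \<tau> T \<and> \<not> tx_commit_pending \<tau> T"

definition transactional :: "('i, 't, 'r, 'p) action list \<Rightarrow> nat \<Rightarrow> bool" where
  "transactional \<tau> i \<longleftrightarrow> (\<exists>T\<in>transactions \<tau>. i \<in> T)"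

definition response_at :: "('i, 't, 'r, 'p) action list \<Rightarrow> nat \<Rightarrow> nat \<Rightarrow> bool" where
  "response_at \<tau> i j \<longleftrightarrow> i < j \<and> j < length \<tau> \<and> matching (\<tau> ! i) (\<tau> ! j) \<and>
     (\<forall>k. i < k \<and> k < j \<longrightarrow> thr (\<tau> ! k) \<noteq> thr (\<tau> ! i))"

definition nontx_accesses :: "('i, 't, 'r, 'p) action list \<Rightarrow> nat set set" where
  "nontx_accesses \<tau> = {{i, j} | i j. response_at \<tau> i j \<and> is_access_request (\<tau> ! i) \<and>
     \<not> transactional \<tau> i \<and> \<not> transactional \<tau> j}"

definition is_history :: "('i, 't, 'r, 'p) action list \<Rightarrow> bool" where
  "is_history H \<longleftrightarrow>
     (\<forall>\<alpha>\<in>set H. is_interface \<alpha>) \<and>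
     distinct (map aid H) \<and>
     (\<forall>t. let h = proj t H in
        \<forall>i<length h. if even i then is_request (h ! i) else matching (h ! (i - 1)) (h ! i)) \<and>
     (\<forall>t. let h = filter (\<lambda>\<alpha>. akind \<alpha> = Some BeginTx \<or> is_completing \<alpha>) (proj t H) in
        \<forall>i<length h. if even i then akind (h ! i) = Some BeginTx else is_completing (h ! i)) \<and>
     (\<forall>i<length H. akind (H ! i) = Some TryCommit \<longrightarrow> transactional H i) \<and>
     (\<forall>i<length H. is_access_request (H ! i) \<and> \<not> transactional H i \<longrightarrow>
        response_at H i (Suc i) \<and> akind (H ! Suc i) \<noteq> Some Aborted)"

definition is_TM :: "('i, 't, 'r, 'p) action list set \<Rightarrow> bool" where
  "is_TM \<H> \<longleftrightarrow>
     (\<forall>H\<in>\<H>. is_history H) \<and>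
     (\<forall>H\<in>\<H>. \<forall>H'. prefix H' H \<and> is_history H' \<longrightarrow> H' \<in> \<H>) \<and>
     (\<forall>H\<in>\<H>. \<forall>\<alpha>. is_request \<alpha> \<and> is_history (H @ [\<alpha>]) \<longrightarrow> H @ [\<alpha>] \<in> \<H>)"

definition non_interleaved :: "('i, 't, 'r, 'p) action list \<Rightarrow> bool" where
  "non_interleaved H \<longleftrightarrow>
     (\<forall>T\<in>transactions H. \<forall>U\<in>transactions H \<union> nontx_accesses H. U \<noteq> T \<longrightarrow>
        (\<forall>i\<in>T. \<forall>j\<in>U. i < j) \<or> (\<forall>i\<in>T. \<forall>j\<in>U. j < i))"

definition is_completion ::
    "('i, 't, 'r, 'p) action list \<Rightarrow> ('i, 't, 'r, 'p) action list \<Rightarrow> bool" where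
  "is_completion H Hc \<longleftrightarrow> is_history Hc \<and> non_interleaved Hc \<and>
     (\<forall>T\<in>transactions Hc. \<not> tx_commit_pending Hc T) \<and>
     subseq H Hc \<and> (\<forall>\<alpha>\<in>set Hc - set H. is_completing \<alpha>)"

text \<open>
  The positions of the writes to \<open>x\<close> that are visible to a read whose response is at
  position \<open>j\<close>.
\<close>

definition visible_writes :: "('i, 't, 'r, 'p) action list \<Rightarrow> 'r \<Rightarrow> nat \<Rightarrow> nat set" where
  "visible_writes H x j = {k. k < j \<and> (\<exists>w. akind (H ! k) = Some (Write x w)) \<and>
     \<not> (\<exists>T\<in>transactions H. k \<in> T \<and> (tx_aborted H T \<or> tx_live H T) \<and> j \<notin> T)}"

definition reads_legal :: "int \<Rightarrow> ('i, 't, 'r, 'p) action list \<Rightarrow> bool" where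
  "reads_legal v_init H \<longleftrightarrow>
     (\<forall>i j x v. response_at H i j \<and> akind (H ! i) = Some (Read x) \<and>
        akind (H ! j) = Some (RetVal v) \<longrightarrow>
        (if visible_writes H x j = {} then v = v_init
         else akind (H ! Max (visible_writes H x j)) = Some (Write x v)))"

definition H_atomic :: "int \<Rightarrow> ('i, 't, 'r, 'p) action list set" where
  "H_atomic v_init = {H. is_history H \<and> non_interleaved H \<and>
     (\<exists>Hc. is_completion H Hc \<and> reads_legal v_init Hc)}"

text \<open>
  The orders below relate positions; as identifiers in a history are distinct, positions
  correspond one-to-one to the actions occurring in it.
\<close>

definition po :: "('i, 't, 'r, 'p) action list \<Rightarrow> (nat \<times> nat) set" where
  "po H = {(i, j). i < j \<and> j < length H \<and> thr (H ! i) = thr (H ! j)}"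

definition ef :: "('i, 't, 'r, 'p) action list \<Rightarrow> (nat \<times> nat) set" where
  "ef H = {(i, j). i < j \<and> j < length H \<and>
     (\<exists>T\<in>transactions H. \<exists>T'\<in>transactions H. T \<noteq> T' \<and> i \<in> T \<and> j \<in> T')}"

definition cl :: "('i, 't, 'r, 'p) action list \<Rightarrow> (nat \<times> nat) set" where
  "cl H = {(i, j). i < j \<and> j < length H \<and> \<not> transactional H i \<and> \<not> transactional H j}"

definition corresponds ::
    "('i, 't, 'r, 'p) action list \<Rightarrow> ('i, 't, 'r, 'p) action list \<Rightarrow> bool"
    (infix "\<sqsubseteq>\<^sub>H" 50) where
  "H1 \<sqsubseteq>\<^sub>H H2 \<longleftrightarrow> (\<exists>\<theta>. bij_betw \<theta> {..<length H1} {..<length H2} \<and>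
     (\<forall>i<length H1. H1 ! i = H2 ! \<theta> i) \<and>
     (\<forall>i j. (i, j) \<in> po H1 \<union> cl H1 \<longrightarrow> \<theta> i < \<theta> j))"

definition hb :: "('i, 't, 'r, 'p) action list \<Rightarrow> (nat \<times> nat) set" where
  "hb H = (po H \<union> ef H \<union> cl H)\<^sup>+"

definition conflicting_kinds :: "'r kind \<Rightarrow> 'r kind \<Rightarrow> bool" where
  "conflicting_kinds k k' \<longleftrightarrow> (\<exists>x v w.
     (k = Write x v \<and> k' = Write x w) \<or> (k = Write x v \<and> k' = Read x) \<or>
     (k = Read x \<and> k' = Write x w))"

definition conflict :: "('i, 't, 'r, 'p) action list \<Rightarrow> nat \<Rightarrow> nat \<Rightarrow> bool" where
  "conflict H i j \<longleftrightarrow> i < length H \<and> j < length H \<and>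
     \<not> transactional H i \<and> transactional H j \<and> thr (H ! i) \<noteq> thr (H ! j) \<and>
     (\<exists>k k'. akind (H ! i) = Some k \<and> akind (H ! j) = Some k' \<and> conflicting_kinds k k')"

definition TDRF :: "('i, 't, 'r, 'p) action list \<Rightarrow> bool" where
  "TDRF H \<longleftrightarrow> (\<forall>i j. conflict H i j \<longrightarrow> (i, j) \<in> hb H \<or> (j, i) \<in> hb H)"

definition CDRF :: "int \<Rightarrow> ('i, 't, 'r, 'p) action list \<Rightarrow> bool" where
  "CDRF v_init H \<longleftrightarrow> (\<forall>S\<in>H_atomic v_init. H \<sqsubseteq>\<^sub>H S \<longrightarrow> TDRF S)"

definition privatization_safe_opaque :: "int \<Rightarrow> ('i, 't, 'r, 'p) action list set \<Rightarrow> bool" where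
  "privatization_safe_opaque v_init \<H> \<longleftrightarrow>
     (\<forall>H\<in>\<H>. CDRF v_init H \<longrightarrow> (\<exists>S\<in>H_atomic v_init. H \<sqsubseteq>\<^sub>H S))"

text \<open>
  A valuation of the local variables of thread \<open>t\<close> is represented by an extensional function
  on \<open>LVar t\<close>.  Expressions are shallowly embedded; they are only ever evaluated on such
  thread-local valuations and hence depend only on the variables of the executing thread.
\<close>

type_synonym 'l bexp = "('l \<Rightarrow> int) \<Rightarrow> bool"
type_synonym 'l iexp = "('l \<Rightarrow> int) \<Rightarrow> int"
type_synonym 'l state = "'l \<Rightarrow> int"

text \<open>
  The parameters of the programming language: the local variables of each thread, its primitive
  commands other than assignments, their semantics, and the values that atomic blocks return.
\<close>

record ('t, 'l, 'c) language =
  LVar :: "'t \<Rightarrow> 'l set"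
  PComm :: "'t \<Rightarrow> 'c set"
  psem :: "'t \<Rightarrow> 'c \<Rightarrow> ('l \<Rightarrow> int) \<Rightarrow> ('l \<Rightarrow> int) set"
  committed_val :: int
  aborted_val :: int

definition wf_language :: "('t, 'l, 'c) language \<Rightarrow> bool" where
  "wf_language L \<longleftrightarrow> disjoint_family (LVar L) \<and>
     (\<forall>t. \<forall>c\<in>PComm L t. \<forall>q\<in>extensional (LVar L t). psem L t c q \<subseteq> extensional (LVar L t)) \<and>
     committed_val L \<noteq> aborted_val L"

datatype ('l, 'c) pcmd = Assume "'l bexp" | Assign 'l "'l iexp" | Basic 'c

fun pcmd_of :: "('t, 'l, 'c) language \<Rightarrow> 't \<Rightarrow> ('l, 'c) pcmd \<Rightarrow> bool" where
  "pcmd_of L t (Assume b) = True"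
| "pcmd_of L t (Assign l e) = (l \<in> LVar L t)"
| "pcmd_of L t (Basic c) = (c \<in> PComm L t)"

fun pcmd_sem ::
    "('t, 'l, 'c) language \<Rightarrow> 't \<Rightarrow> ('l, 'c) pcmd \<Rightarrow> ('l \<Rightarrow> int) \<Rightarrow> ('l \<Rightarrow> int) set" where
  "pcmd_sem L t (Assume b) q = (if b q then {q} else {})"
| "pcmd_sem L t (Assign l e) q = {q(l := e q)}"
| "pcmd_sem L t (Basic c) q = psem L t c q"

datatype ('r, 'l, 'c) com =
    Prim "('l, 'c) pcmd"
  | Seq "('r, 'l, 'c) com" "('r, 'l, 'c) com"
  | If "'l bexp" "('r, 'l, 'c) com" "('r, 'l, 'c) com"
  | While "'l bexp" "('r, 'l, 'c) com"
  | Atomic 'l "('r, 'l, 'c) com"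
  | ReadReg 'l 'r
  | WriteReg 'r "'l iexp"

type_synonym ('t, 'r, 'l, 'c) program = "'t \<Rightarrow> ('r, 'l, 'c) com"

fun atomic_free :: "('r, 'l, 'c) com \<Rightarrow> bool" where
  "atomic_free (Seq C1 C2) = (atomic_free C1 \<and> atomic_free C2)"
| "atomic_free (If b C1 C2) = (atomic_free C1 \<and> atomic_free C2)"
| "atomic_free (While b C) = atomic_free C"
| "atomic_free (Atomic l C) = False"
| "atomic_free _ = True"

fun wf_com :: "('t, 'l, 'c) language \<Rightarrow> 't \<Rightarrow> ('r, 'l, 'c) com \<Rightarrow> bool" where
  "wf_com L t (Prim c) = (pcmd_of L t c \<and> (\<forall>b. c \<noteq> Assume b))"
| "wf_com L t (Seq C1 C2) = (wf_com L t C1 \<and> wf_com L t C2)"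
| "wf_com L t (If b C1 C2) = (wf_com L t C1 \<and> wf_com L t C2)"
| "wf_com L t (While b C) = wf_com L t C"
| "wf_com L t (Atomic l C) = (l \<in> LVar L t \<and> atomic_free C \<and> wf_com L t C)"
| "wf_com L t (ReadReg l x) = (l \<in> LVar L t)"
| "wf_com L t (WriteReg x e) = True"

definition wf_program :: "('t, 'l, 'c) language \<Rightarrow> ('t, 'r, 'l, 'c) program \<Rightarrow> bool" where
  "wf_program L P \<longleftrightarrow> (\<forall>t. wf_com L t (P t))"

type_synonym ('i, 't, 'r, 'l, 'c) trace = "('i, 't, 'r, ('l, 'c) pcmd) action list"

definition history :: "('i, 't, 'r, 'p) action list \<Rightarrow> ('i, 't, 'r, 'p) action list" where
  "history \<tau> = filter is_interface \<tau>"

definition is_trace :: "('t, 'l, 'c) language \<Rightarrow> ('i, 't, 'r, 'l, 'c) trace \<Rightarrow> bool" where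
  "is_trace L \<tau> \<longleftrightarrow>
     distinct (map aid \<tau>) \<and>
     (\<forall>a t c. PAct a t c \<in> set \<tau> \<longrightarrow> pcmd_of L t c) \<and>
     is_history (history \<tau>) \<and>
     (\<forall>t i. Suc i < length (proj t \<tau>) \<and> is_request (proj t \<tau> ! i) \<longrightarrow>
        is_interface (proj t \<tau> ! Suc i)) \<and>
     (\<forall>i<length \<tau>. is_request (\<tau> ! i) \<and> \<not> transactional \<tau> i \<longrightarrow> response_at \<tau> i (Suc i))"

definition conc :: "'a list set \<Rightarrow> 'a list set \<Rightarrow> 'a list set" (infixr "\<cdot>" 75) where
  "X \<cdot> Y = {xs @ ys | xs ys. xs \<in> X \<and> ys \<in> Y}"

primrec conc_pow :: "'a list set \<Rightarrow> nat \<Rightarrow> 'a list set" where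
  "conc_pow X 0 = {[]}"
| "conc_pow X (Suc n) = X \<cdot> conc_pow X n"

definition iact :: "'t \<Rightarrow> 'r kind \<Rightarrow> ('i, 't, 'r, 'l, 'c) trace set" where
  "iact t k = {[IAct a t k] | a. True}"

definition pact :: "'t \<Rightarrow> ('l, 'c) pcmd \<Rightarrow> ('i, 't, 'r, 'l, 'c) trace set" where
  "pact t c = {[PAct a t c] | a. True}"

definition no_abort :: "('i, 't, 'r, 'p) action list \<Rightarrow> bool" where
  "no_abort \<tau> \<longleftrightarrow> (\<forall>\<alpha>\<in>set \<tau>. akind \<alpha> \<noteq> Some Aborted)"

text \<open>
  In the second case of \<open>Atomic\<close>, the body is cut off at its first \<open>aborted\<close> response;
  outside atomic blocks, aborted accesses are excluded by the definition of traces.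
\<close>

primrec com_seqs ::
    "('t, 'l, 'c) language \<Rightarrow> 't \<Rightarrow> ('r, 'l, 'c) com \<Rightarrow> ('i, 't, 'r, 'l, 'c) trace set" where
  "com_seqs L t (Prim c) = pact t c"
| "com_seqs L t (Seq C1 C2) = com_seqs L t C1 \<cdot> com_seqs L t C2"
| "com_seqs L t (If b C1 C2) =
     pact t (Assume b) \<cdot> com_seqs L t C1 \<union> pact t (Assume (\<lambda>q. \<not> b q)) \<cdot> com_seqs L t C2"
| "com_seqs L t (While b C) =
     (\<Union>n. conc_pow (pact t (Assume b) \<cdot> com_seqs L t C) n) \<cdot> pact t (Assume (\<lambda>q. \<not> b q))"
| "com_seqs L t (Atomic l C) =
     iact t BeginTx \<cdot> iact t Aborted \<cdot> pact t (Assign l (\<lambda>_. aborted_val L)) \<union>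
     iact t BeginTx \<cdot> iact t Ok \<cdot>
       {\<tau> @ [IAct a t Aborted] | \<tau> a. no_abort \<tau> \<and>
          (\<exists>\<rho>\<in>com_seqs L t C. prefix (\<tau> @ [IAct a t Aborted]) \<rho>)} \<cdot>
       pact t (Assign l (\<lambda>_. aborted_val L)) \<union>
     iact t BeginTx \<cdot> iact t Ok \<cdot> {\<tau> \<in> com_seqs L t C. no_abort \<tau>} \<cdot> iact t TryCommit \<cdot>
       (iact t Committed \<cdot> pact t (Assign l (\<lambda>_. committed_val L)) \<union>
        iact t Aborted \<cdot> pact t (Assign l (\<lambda>_. aborted_val L)))"
| "com_seqs L t (ReadReg l x) =
     (\<Union>v. iact t (Read x) \<cdot> iact t (RetVal v) \<cdot> pact t (Assign l (\<lambda>_. v))) \<union>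
     iact t (Read x) \<cdot> iact t Aborted"
| "com_seqs L t (WriteReg x e) =
     (\<Union>v. pact t (Assume (\<lambda>q. e q = v)) \<cdot> iact t (Write x v) \<cdot>
        (iact t RetUnit \<union> iact t Aborted))"

text \<open>
  All actions of a sequence in \<open>com_seqs L t C\<close> are by thread \<open>t\<close>, so \<open>\<rho>\<close> is an interleaving of
  such sequences, one for each thread, iff its projections are these sequences.
\<close>

definition program_traces ::
    "('t, 'l, 'c) language \<Rightarrow> ('t, 'r, 'l, 'c) program \<Rightarrow> ('i, 't, 'r, 'l, 'c) trace set" where
  "program_traces L P = {\<tau>. is_trace L \<tau> \<and>
     (\<exists>\<rho>. prefix \<tau> \<rho> \<and> (\<forall>t. proj t \<rho> \<in> com_seqs L t (P t)))}"

fun eval_action ::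
    "('t, 'l, 'c) language \<Rightarrow> ('i, 't, 'r, ('l, 'c) pcmd) action \<Rightarrow> 'l state \<Rightarrow> 'l state set" where
  "eval_action L (IAct a t k) s = {s}"
| "eval_action L (PAct a t c) s =
     {s'. restrict s' (LVar L t) \<in> pcmd_sem L t c (restrict s (LVar L t)) \<and>
          (\<forall>l. l \<notin> LVar L t \<longrightarrow> s' l = s l)}"

primrec eval_actions ::
    "('t, 'l, 'c) language \<Rightarrow> 'l state \<Rightarrow> ('i, 't, 'r, 'l, 'c) trace \<Rightarrow> 'l state set" where
  "eval_actions L s [] = {s}"
| "eval_actions L s (\<alpha> # \<tau>) = (\<Union>s'\<in>eval_action L \<alpha> s. eval_actions L s' \<tau>)"

definition remove_aborted :: "('i, 't, 'r, 'p) action list \<Rightarrow> ('i, 't, 'r, 'p) action list" where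
  "remove_aborted \<tau> = nths \<tau> {i. \<not> (\<exists>T\<in>transactions \<tau>. tx_aborted \<tau> T \<and> i \<in> T)}"

text \<open>
  In a strict prefix of a trace a transaction that aborts later is still live, so its actions
  do have to be executable.
\<close>

function eval ::
    "('t, 'l, 'c) language \<Rightarrow> 'l state \<Rightarrow> ('i, 't, 'r, 'l, 'c) trace \<Rightarrow> 'l state set" where
  "eval L s \<tau> =
     (if \<tau> = [] then {s}
      else if eval L s (butlast \<tau>) = {} then {}
      else eval_actions L s (remove_aborted \<tau>))"
  by pat_completeness auto
termination
  by (relation "measure (\<lambda>(L, s, \<tau>). length \<tau>)") auto

declare eval.simps [simp del]

definition program_sem ::
    "('t, 'l, 'c) language \<Rightarrow> ('t, 'r, 'l, 'c) program \<Rightarrow>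
     ('i, 't, 'r, ('l, 'c) pcmd) action list set \<Rightarrow> ('i, 't, 'r, 'l, 'c) trace set" where
  "program_sem L P \<H> =
     {\<tau> \<in> program_traces L P. (\<exists>s. eval L s \<tau> \<noteq> {}) \<and> history \<tau> \<in> \<H>}"

text \<open>The type argument only fixes the identifiers that occur in the traces of \<open>P\<close>.\<close>

definition TDRF_program ::
    "'i itself \<Rightarrow> ('t, 'l, 'c) language \<Rightarrow> int \<Rightarrow> ('t, 'r, 'l, 'c) program \<Rightarrow> bool" where
  "TDRF_program _ L v_init P \<longleftrightarrow>
     (\<forall>\<tau> :: ('i, 't, 'r, 'l, 'c) trace. \<tau> \<in> program_sem L P (H_atomic v_init) \<longrightarrow>
        TDRF (history \<tau>))"

definition nontx :: "('i, 't, 'r, 'p) action list \<Rightarrow> ('i, 't, 'r, 'p) action list" where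
  "nontx \<tau> = nths \<tau> (\<Union> (nontx_accesses \<tau>))"

definition obs_equiv ::
    "('i, 't, 'r, 'p) action list \<Rightarrow> ('i, 't, 'r, 'p) action list \<Rightarrow> bool" (infix "\<sim>" 50) where
  "\<tau> \<sim> \<tau>' \<longleftrightarrow> (\<forall>t. proj t \<tau> = proj t \<tau>') \<and> nontx \<tau> = nontx \<tau>'"

definition obs_refines ::
    "('i, 't, 'r, 'p) action list set \<Rightarrow> ('i, 't, 'r, 'p) action list set \<Rightarrow> bool"
    (infix "\<preceq>" 50) where
  "X \<preceq> Y \<longleftrightarrow> (\<forall>\<tau>\<in>X. \<exists>\<tau>'\<in>Y. \<tau> \<sim> \<tau>')"

end

theory Submission
  imports Defs "HOL-Library.Multiset"
begin

text \<open>
  If a trace \<open>\<tau>\<close> of \<open>P\<close> has a history corresponding to an atomic history \<open>S\<close>, then inserting the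
  primitive actions of each thread into \<open>S\<close> gives a trace \<open>\<tau>'\<close> of \<open>P\<close> with history \<open>S\<close> and
  \<open>\<tau> \<sim> \<tau>'\<close>: which actions are transactional or aborted, and whether a trace can be evaluated, depend
  only on the projections to single threads, because local variables are not shared; the order of
  the non-transactional accesses is preserved because correspondence preserves the client order.
  Applied to an arbitrary such \<open>S\<close>, this turns data-race freedom of \<open>P\<close> into \<open>CDRF\<close> of the
  history of \<open>\<tau>\<close>; applied to the \<open>S\<close> that opacity then provides, it gives the required trace.
\<close>

section \<open>Splitting lists at a distinguished element, and the effect of filters\<close>

text \<open>Transactions are defined by positions, while filters act on list splits; this and the
  next lemma translate between the two views.\<close>

lemma ex_split_nth:
  "(\<exists>u c v. xs = u @ c # v \<and> R c \<and> (\<forall>x\<in>set u. Q x)) \<longleftrightarrow>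
   (\<exists>i<length xs. R (xs ! i) \<and> (\<forall>j<i. Q (xs ! j)))" (is "?l \<longleftrightarrow> ?r")
proof
  assume ?l
  then obtain u c v where "xs = u @ c # v" "R c" "\<forall>x\<in>set u. Q x" by blast
  then show ?r by (intro exI[of _ "length u"]) (auto simp: nth_append)
next
  assume ?r
  then obtain i where i: "i < length xs" "R (xs ! i)" "\<forall>j<i. Q (xs ! j)" by blast
  have "xs = take i xs @ xs ! i # drop (Suc i) xs" using i(1) by (rule id_take_nth_drop)
  moreover have "\<forall>x\<in>set (take i xs). Q x" using i by (auto simp: in_set_conv_nth)
  ultimately show ?l using i(2) by blast
qed

lemma ex_split_last_nth:
  "(\<exists>u c v. xs = u @ c # v \<and> R c \<and> (\<forall>x\<in>set v. Q x)) \<longleftrightarrow>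
   (\<exists>i<length xs. R (xs ! i) \<and> (\<forall>j. i < j \<and> j < length xs \<longrightarrow> Q (xs ! j)))" (is "?l \<longleftrightarrow> ?r")
proof
  assume ?l
  then obtain u c v where xs: "xs = u @ c # v" "R c" "\<forall>x\<in>set v. Q x" by blast
  have "Q (xs ! j)" if "length u < j" "j < length xs" for j
  proof -
    have "xs ! j = v ! (j - Suc (length u))" "j - Suc (length u) < length v"
      using that xs(1) by (auto simp: nth_append nth_Cons')
    then show ?thesis using xs(3) by simp
  qed
  with xs(1,2) show ?r by (intro exI[of _ "length u"]) auto
next
  assume ?r
  then obtain i where i: "i < length xs" "R (xs ! i)" "\<forall>j. i < j \<and> j < length xs \<longrightarrow> Q (xs ! j)"
    by blast
  have "xs = take i xs @ xs ! i # drop (Suc i) xs" using i(1) by (rule id_take_nth_drop)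
  moreover have "\<forall>x\<in>set (drop (Suc i) xs). Q x" using i by (auto simp: in_set_conv_nth)
  ultimately show ?l using i(2) by blast
qed

lemma filter_eq_appendE:
  assumes "filter P xs = ys @ zs"
  obtains us vs where "xs = us @ vs" "filter P us = ys" "filter P vs = zs"
  using assms
proof (induction xs arbitrary: ys thesis)
  case Nil
  then show ?case by simp
next
  case (Cons x xs)
  show ?case
  proof (cases "P x \<and> ys = []")
    case True
    then show ?thesis using Cons.prems(1)[of "[]" "x # xs"] Cons.prems(2) by simp
  next
    case False
    then have "filter P xs = (if P x then tl ys else ys) @ zs"
      using Cons.prems(2) by (cases ys) auto
    then obtain us vs where
      "xs = us @ vs" "filter P us = (if P x then tl ys else ys)" "filter P vs = zs"
      using Cons.IH by blast
    then show ?thesis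
      using Cons.prems(1)[of "x # us" vs] Cons.prems(2) False by (cases ys) (auto split: if_splits)
  qed
qed

text \<open>Elements that \<open>P\<close> drops may stand anywhere, so in \<open>s\<close> the
  condition on \<open>u\<close> is relativised to \<open>P\<close>. This and its mirror image below
  move facts about a thread's past and future between a sequence and its filtered versions.\<close>

lemma ex_split_filter:
  "(\<exists>u c v. filter P s = u @ c # v \<and> R c \<and> (\<forall>x\<in>set u. Q x)) \<longleftrightarrow>
   (\<exists>u c v. s = u @ c # v \<and> P c \<and> R c \<and> (\<forall>x\<in>set u. P x \<longrightarrow> Q x))" (is "?l \<longleftrightarrow> ?r")
proof
  assume ?l
  then obtain u c v where *: "filter P s = u @ c # v" "R c" "\<forall>x\<in>set u. Q x" by blast
  obtain u' v' where "s = u' @ v'" "filter P u' = u" "filter P v' = c # v"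
    using *(1) by (rule filter_eq_appendE)
  moreover from this(3) obtain w z where "v' = w @ c # z" "\<forall>x\<in>set w. \<not> P x" "P c"
    by (auto simp: filter_eq_Cons_iff)
  ultimately show ?r using *(2,3)
    by (intro exI[of _ "u' @ w"] exI[of _ c] exI[of _ z]) auto
next
  assume ?r
  then obtain u c v where "s = u @ c # v" "P c" "R c" "\<forall>x\<in>set u. P x \<longrightarrow> Q x" by blast
  then show ?l by (intro exI[of _ "filter P u"] exI[of _ c] exI[of _ "filter P v"]) auto
qed

lemma ex_split_last_filter:
  "(\<exists>u c v. filter P s = u @ c # v \<and> R c \<and> (\<forall>x\<in>set v. Q x)) \<longleftrightarrow>
   (\<exists>u c v. s = u @ c # v \<and> P c \<and> R c \<and> (\<forall>x\<in>set v. P x \<longrightarrow> Q x))" (is "?l \<longleftrightarrow> ?r")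
proof
  assume ?l
  then obtain u c v where *: "filter P s = u @ c # v" "R c" "\<forall>x\<in>set v. Q x" by blast
  obtain u' v' where "s = u' @ v'" "filter P u' = u" "filter P v' = c # v"
    using *(1) by (rule filter_eq_appendE)
  moreover from this(3) obtain w z where "v' = w @ c # z" "filter P z = v" "P c"
    by (auto simp: filter_eq_Cons_iff)
  ultimately show ?r using *(2,3)
    by (intro exI[of _ "u' @ w"] exI[of _ c] exI[of _ z]) auto
next
  assume ?r
  then obtain u c v where "s = u @ c # v" "P c" "R c" "\<forall>x\<in>set v. P x \<longrightarrow> Q x" by blast
  then show ?l by (intro exI[of _ "filter P u"] exI[of _ c] exI[of _ "filter P v"]) auto
qed

text \<open>\<open>\<theta>\<close> maps the increasing list of positions in \<open>xs\<close> where
  \<open>P\<close> holds to a strictly increasing list with the same elements as the one for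
  \<open>ys\<close>; strictly sorted lists with equal sets coincide.\<close>

lemma filter_eq_of_order_preserving_bij:
  assumes bij: "bij_betw \<theta> {..<length xs} {..<length ys}"
    and nth: "\<And>i. i < length xs \<Longrightarrow> xs ! i = ys ! \<theta> i"
    and mono: "\<And>i j. i < j \<Longrightarrow> j < length xs \<Longrightarrow> P (xs ! i) \<Longrightarrow> P (xs ! j) \<Longrightarrow> \<theta> i < \<theta> j"
  shows "filter P xs = filter P ys"
proof -
  have filt: "filter P zs = map (nth zs) (filter (\<lambda>i. P (zs ! i)) [0..<length zs])" for zs
    by (metis (no_types, lifting) comp_apply filter_cong filter_map map_nth)
  let ?I = "filter (\<lambda>i. P (xs ! i)) [0..<length xs]"
  let ?J = "filter (\<lambda>i. P (ys ! i)) [0..<length ys]"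
  have "sorted_wrt (<) ?I" by (simp add: sorted_wrt_filter)
  then have "sorted_wrt (\<lambda>i j. \<theta> i < \<theta> j) ?I"
    by (rule sorted_wrt_mono_rel[rotated]) (auto intro: mono)
  then have s1: "sorted_wrt (<) (map \<theta> ?I)" by (simp add: sorted_wrt_map)
  have s2: "sorted_wrt (<) ?J" by (simp add: sorted_wrt_filter)
  have "set (map \<theta> ?I) = \<theta> ` {i\<in>{..<length xs}. P (ys ! \<theta> i)}"
    using nth by (auto simp: image_iff)
  also have "\<dots> = {j\<in>\<theta> ` {..<length xs}. P (ys ! j)}" by auto
  also have "\<dots> = set ?J" using bij by (auto simp: bij_betw_def)
  finally have "map \<theta> ?I = ?J" using s1 s2 by (intro strict_sorted_equal) auto
  then have "filter P ys = map (nth ys) (map \<theta> ?I)" by (subst filt) simp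
  also have "\<dots> = map (nth xs) ?I" using nth by simp
  finally show ?thesis using filt[of xs] by simp
qed

subsection \<open>Transactions, thread by thread\<close>

text \<open>An open transaction, read off the past \<open>p\<close> alone. A list split instead of
  positions keeps it stable under projection to the thread or to interface actions.\<close>

definition in_tx :: "'t \<Rightarrow> ('i, 't, 'r, 'p) action list \<Rightarrow> bool" where
  "in_tx t p \<longleftrightarrow> (\<exists>u b v. p = u @ b # v \<and> (thr b = t \<and> akind b = Some BeginTx) \<and>
     (\<forall>x\<in>set v. thr x = t \<longrightarrow> \<not> is_completing x))"

text \<open>The counterpart for the future \<open>s\<close>: the next completing action of
  \<open>t\<close> exists and is an abort.\<close>

definition aborts_next :: "'t \<Rightarrow> ('i, 't, 'r, 'p) action list \<Rightarrow> bool" where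
  "aborts_next t s \<longleftrightarrow> (\<exists>u c v. s = u @ c # v \<and> (thr c = t \<and> akind c = Some Aborted) \<and>
     (\<forall>x\<in>set u. thr x = t \<longrightarrow> \<not> is_completing x))"

lemma in_tx_proj: "in_tx t (proj t p) \<longleftrightarrow> in_tx t p"
proof -
  have "in_tx t (proj t p) \<longleftrightarrow> (\<exists>u b v. p = u @ b # v \<and> thr b = t \<and>
     (thr b = t \<and> akind b = Some BeginTx) \<and>
     (\<forall>x\<in>set v. thr x = t \<longrightarrow> thr x = t \<longrightarrow> \<not> is_completing x))"
    unfolding in_tx_def proj_def by (rule ex_split_last_filter)
  then show ?thesis by (auto simp: in_tx_def)
qed

lemma in_tx_history:
  fixes p :: "('i, 't, 'r, 'p) action list"
  shows "in_tx t (history p) \<longleftrightarrow> in_tx t p"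
proof -
  have "in_tx t (history p) \<longleftrightarrow> (\<exists>u b v. p = u @ b # v \<and> is_interface b \<and>
     (thr b = t \<and> akind b = Some BeginTx) \<and>
     (\<forall>x\<in>set v. is_interface x \<longrightarrow> thr x = t \<longrightarrow> \<not> is_completing x))"
    unfolding in_tx_def history_def by (rule ex_split_last_filter)
  moreover have "is_interface b \<and> (thr b = t \<and> akind b = Some BeginTx) \<longleftrightarrow>
      thr b = t \<and> akind b = Some BeginTx"
    "(is_interface b \<longrightarrow> thr b = t \<longrightarrow> \<not> is_completing b) \<longleftrightarrow>
      (thr b = t \<longrightarrow> \<not> is_completing b)" for b :: "('i, 't, 'r, 'p) action"
    by (auto simp: is_interface_def is_completing_def)
  ultimately show ?thesis
    unfolding in_tx_def by (simp only: conj_assoc[symmetric]) (simp add: conj_assoc)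
qed

lemma aborts_next_proj: "aborts_next t (proj t s) \<longleftrightarrow> aborts_next t s"
proof -
  have "aborts_next t (proj t s) \<longleftrightarrow> (\<exists>u b v. s = u @ b # v \<and> thr b = t \<and>
     (thr b = t \<and> akind b = Some Aborted) \<and>
     (\<forall>x\<in>set u. thr x = t \<longrightarrow> thr x = t \<longrightarrow> \<not> is_completing x))"
    unfolding aborts_next_def proj_def by (rule ex_split_filter)
  then show ?thesis by (auto simp: aborts_next_def)
qed

lemma in_tx_nth:
  assumes "i \<le> length \<tau>"
  shows "in_tx t (take i \<tau>) \<longleftrightarrow> (\<exists>b<i. (thr (\<tau> ! b) = t \<and> akind (\<tau> ! b) = Some BeginTx) \<and>
    (\<forall>j. b < j \<and> j < i \<longrightarrow> thr (\<tau> ! j) = t \<longrightarrow> \<not> is_completing (\<tau> ! j)))"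
  unfolding in_tx_def ex_split_last_nth using assms by (simp add: min_absorb2 cong: conj_cong)

lemma aborts_next_nth:
  assumes "i < length \<tau>"
  shows "aborts_next t (drop i \<tau>) \<longleftrightarrow> (\<exists>c\<ge>i. c < length \<tau> \<and>
    (thr (\<tau> ! c) = t \<and> akind (\<tau> ! c) = Some Aborted) \<and>
    (\<forall>j. i \<le> j \<and> j < c \<longrightarrow> thr (\<tau> ! j) = t \<longrightarrow> \<not> is_completing (\<tau> ! j)))" (is "?l \<longleftrightarrow> ?r")
proof -
  have "?l \<longleftrightarrow> (\<exists>c<length \<tau> - i. (thr (\<tau> ! (i + c)) = t \<and> akind (\<tau> ! (i + c)) = Some Aborted) \<and>
    (\<forall>j<c. thr (\<tau> ! (i + j)) = t \<longrightarrow> \<not> is_completing (\<tau> ! (i + j))))" (is "_ \<longleftrightarrow> ?m")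
    unfolding aborts_next_def ex_split_nth using assms by (simp cong: conj_cong)
  also have "?m \<longleftrightarrow> ?r"
  proof
    assume ?m
    then obtain c where c: "c < length \<tau> - i" "thr (\<tau> ! (i + c)) = t"
      "akind (\<tau> ! (i + c)) = Some Aborted"
      "\<forall>j<c. thr (\<tau> ! (i + j)) = t \<longrightarrow> \<not> is_completing (\<tau> ! (i + j))" by blast
    have "\<not> is_completing (\<tau> ! j)" if "i \<le> j" "j < i + c" "thr (\<tau> ! j) = t" for j
      using c(4)[rule_format, of "j - i"] that by auto
    then show ?r using c(1-3) by (intro exI[of _ "i + c"]) auto
  next
    assume ?r
    then obtain c where "c \<ge> i" "c < length \<tau>" "thr (\<tau> ! c) = t" "akind (\<tau> ! c) = Some Aborted"
      "\<forall>j. i \<le> j \<and> j < c \<longrightarrow> thr (\<tau> ! j) = t \<longrightarrow> \<not> is_completing (\<tau> ! j)" by blast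
    then show ?m by (intro exI[of _ "c - i"]) auto
  qed
  finally show ?thesis .
qed

text \<open>Supplies the segments that are later compared with maximal ones. \<open>nc\<close>
  spares \<open>c\<close>, as the last action of a segment may be completing.\<close>

lemma tx_segmentI:
  assumes "b \<le> c" "c < length \<tau>" "thr (\<tau> ! b) = t" "thr (\<tau> ! c) = t" "akind (\<tau> ! b) = Some BeginTx"
    and nc: "\<And>j. b \<le> j \<Longrightarrow> j < c \<Longrightarrow> thr (\<tau> ! j) = t \<Longrightarrow> \<not> is_completing (\<tau> ! j)"
  defines "I \<equiv> {j. b \<le> j \<and> j \<le> c \<and> thr (\<tau> ! j) = t}"
  shows "tx_segment \<tau> I" "Max I = c" "b \<in> I" "c \<in> I"
proof -
  have fin: "finite I" unfolding I_def by simp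
  show b: "b \<in> I" and c: "c \<in> I" using assms by (auto simp: I_def)
  have "Min I = b" using b fin by (intro Min_eqI) (auto simp: I_def)
  moreover show "Max I = c" using c fin by (intro Max_eqI) (auto simp: I_def)
  ultimately show "tx_segment \<tau> I"
    unfolding tx_segment_def using assms(2,5) b nc
    by (auto simp: I_def intro!: exI[of _ t])
qed

text \<open>Segments are sets of positions below \<open>length \<tau>\<close>, so there are finitely
  many and each lies in a maximal one.\<close>

lemma tx_segment_extend:
  assumes "tx_segment \<tau> I"
  obtains T where "T \<in> transactions \<tau>" "I \<subseteq> T"
proof -
  have fin: "finite {J. tx_segment \<tau> J}"
    by (rule finite_subset[of _ "Pow {..<length \<tau>}"]) (auto simp: tx_segment_def)
  obtain T where T: "tx_segment \<tau> T" "I \<subseteq> T" "\<And>J. tx_segment \<tau> J \<Longrightarrow> T \<subseteq> J \<Longrightarrow> T = J"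
    using finite_has_maximal2[OF fin, of I] assms by auto
  then show ?thesis using that[of T] by (auto simp: transactions_def)
qed

lemma tx_segmentD:
  assumes "tx_segment \<tau> I" "i \<in> I"
  shows "Min I \<le> i" "i \<le> Max I" "Max I < length \<tau>" "Max I \<in> I" "Min I \<in> I"
    and "thr (\<tau> ! Min I) = thr (\<tau> ! i)" "thr (\<tau> ! Max I) = thr (\<tau> ! i)"
    and "akind (\<tau> ! Min I) = Some BeginTx"
    and "\<And>j. Min I \<le> j \<Longrightarrow> j \<le> Max I \<Longrightarrow> thr (\<tau> ! j) = thr (\<tau> ! i) \<Longrightarrow> j \<in> I"
    and "\<And>j. Min I \<le> j \<Longrightarrow> j < Max I \<Longrightarrow> thr (\<tau> ! j) = thr (\<tau> ! i) \<Longrightarrow> \<not> is_completing (\<tau> ! j)"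
proof -
  have fin: "finite I" and ne: "I \<noteq> {}"
    using assms finite_subset[OF _ finite_lessThan, of I] by (auto simp: tx_segment_def)
  show "Min I \<le> i" "i \<le> Max I" and mem: "Max I \<in> I" "Min I \<in> I"
    using fin ne assms(2) by auto
  then show "Max I < length \<tau>" "akind (\<tau> ! Min I) = Some BeginTx"
    using assms(1) by (auto simp: tx_segment_def)
  obtain t where t: "\<forall>i\<in>I. thr (\<tau> ! i) = t"
    "\<forall>i\<in>I. \<forall>k\<in>I. \<forall>j. i < j \<and> j < k \<and> thr (\<tau> ! j) = t \<longrightarrow> j \<in> I"
    using assms(1) by (auto simp: tx_segment_def)
  show "thr (\<tau> ! Min I) = thr (\<tau> ! i)" "thr (\<tau> ! Max I) = thr (\<tau> ! i)"
    using t(1) mem assms(2) by auto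
  show *: "j \<in> I" if "Min I \<le> j" "j \<le> Max I" "thr (\<tau> ! j) = thr (\<tau> ! i)" for j
    using t mem assms(2) that by (metis le_neq_implies_less)
  show "\<not> is_completing (\<tau> ! j)" if "Min I \<le> j" "j < Max I" "thr (\<tau> ! j) = thr (\<tau> ! i)" for j
    using * that assms(1) by (auto simp: tx_segment_def)
qed

text \<open>Maximality disappears here: the open \<open>BeginTx\<close> in the past and position
  \<open>i\<close> span a segment, and any segment extends to a transaction. A
  \<open>BeginTx\<close> at \<open>i\<close> is a separate case because \<open>take i \<tau>\<close>
  stops before \<open>i\<close>.\<close>

lemma transactional_iff:
  assumes i: "i < length \<tau>"
  shows "transactional \<tau> i \<longleftrightarrow>
    in_tx (thr (\<tau> ! i)) (take i \<tau>) \<or> akind (\<tau> ! i) = Some BeginTx" (is "_ \<longleftrightarrow> ?r")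
proof
  assume "transactional \<tau> i"
  then obtain T where T: "tx_segment \<tau> T" "i \<in> T"
    by (auto simp: transactional_def transactions_def)
  note * = tx_segmentD[OF T]
  show ?r
  proof (cases "Min T = i")
    case False
    then have "in_tx (thr (\<tau> ! i)) (take i \<tau>)"
      using * i by (subst in_tx_nth) (auto intro!: exI[of _ "Min T"])
    then show ?thesis ..
  qed (use * in auto)
next
  assume ?r
  then have "\<exists>b\<le>i. thr (\<tau> ! b) = thr (\<tau> ! i) \<and> akind (\<tau> ! b) = Some BeginTx \<and>
    (\<forall>j. b < j \<and> j < i \<longrightarrow> thr (\<tau> ! j) = thr (\<tau> ! i) \<longrightarrow> \<not> is_completing (\<tau> ! j))"
  proof
    assume "in_tx (thr (\<tau> ! i)) (take i \<tau>)"
    then show ?thesis using i by (subst (asm) in_tx_nth) (auto dest: less_imp_le)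
  qed (auto intro!: exI[of _ i])
  then obtain b where b: "b \<le> i" "thr (\<tau> ! b) = thr (\<tau> ! i)" "akind (\<tau> ! b) = Some BeginTx"
    "\<And>j. b < j \<Longrightarrow> j < i \<Longrightarrow> thr (\<tau> ! j) = thr (\<tau> ! i) \<Longrightarrow> \<not> is_completing (\<tau> ! j)"
    by blast
  \<comment> \<open>The choice of \<open>b\<close> says nothing about \<open>b\<close> itself, but a
    \<open>BeginTx\<close> is not completing.\<close>
  have "\<not> is_completing (\<tau> ! j)" if "b \<le> j" "j < i" "thr (\<tau> ! j) = thr (\<tau> ! i)" for j
    using b that by (cases "j = b") (auto simp: is_completing_def)
  note seg = tx_segmentI[OF b(1) i b(2) refl b(3) this]
  obtain T where "T \<in> transactions \<tau>" "i \<in> T" using tx_segment_extend[OF seg(1)] seg(4) by blast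
  then show "transactional \<tau> i" by (auto simp: transactional_def)
qed

text \<open>If the thread's next completion is an abort at \<open>c\<close>, the transaction
  \<open>T\<close> of \<open>i\<close> ends there: prolonging \<open>T\<close> up to
  \<open>c\<close> gives a segment, which by maximality is \<open>T\<close> itself.\<close>

lemma in_aborted_iff:
  assumes i: "i < length \<tau>"
  shows "(\<exists>T\<in>transactions \<tau>. tx_aborted \<tau> T \<and> i \<in> T) \<longleftrightarrow>
    transactional \<tau> i \<and> aborts_next (thr (\<tau> ! i)) (drop i \<tau>)" (is "?l \<longleftrightarrow> ?r")
proof
  assume ?l
  then obtain T where T: "T \<in> transactions \<tau>" "tx_aborted \<tau> T" "i \<in> T" by blast
  then have "tx_segment \<tau> T" by (simp add: transactions_def)
  note * = tx_segmentD[OF this T(3)]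
  have "aborts_next (thr (\<tau> ! i)) (drop i \<tau>)"
    using * T(2) i by (subst aborts_next_nth) (auto intro!: exI[of _ "Max T"] simp: tx_aborted_def)
  then show ?r using T by (auto simp: transactional_def)
next
  assume r: ?r
  then obtain c where c: "i \<le> c" "c < length \<tau>" "thr (\<tau> ! c) = thr (\<tau> ! i)"
    "akind (\<tau> ! c) = Some Aborted"
    "\<And>j. i \<le> j \<Longrightarrow> j < c \<Longrightarrow> thr (\<tau> ! j) = thr (\<tau> ! i) \<Longrightarrow> \<not> is_completing (\<tau> ! j)"
    using i by (auto simp: aborts_next_nth)
  obtain T where T: "T \<in> transactions \<tau>" "i \<in> T" using r by (auto simp: transactional_def)
  then have seg: "tx_segment \<tau> T" by (simp add: transactions_def)
  note * = tx_segmentD[OF seg T(2)]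
  \<comment> \<open>Before \<open>i\<close> this is a property of \<open>T\<close>; from
    \<open>i\<close> on it comes from the choice of \<open>c\<close>.\<close>
  have nc: "\<not> is_completing (\<tau> ! j)" if "Min T \<le> j" "j < c" "thr (\<tau> ! j) = thr (\<tau> ! i)" for j
    using c(5) *(10) *(2) that by (cases "j < i") auto
  have "Min T \<le> c" using *(1) c(1) by simp
  note J = tx_segmentI[OF this c(2) *(6) c(3) *(8) nc]
  \<comment> \<open>Otherwise \<open>c\<close> would be a completing action of \<open>T\<close>
    before its last one.\<close>
  have "Max T \<le> c"
  proof (rule ccontr)
    assume "\<not> Max T \<le> c"
    with *(10)[of c] *(1) c show False by (auto simp: is_completing_def)
  qed
  then have "T \<subseteq> {j. Min T \<le> j \<and> j \<le> c \<and> thr (\<tau> ! j) = thr (\<tau> ! i)}"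
    using tx_segmentD(1,2,6)[OF seg] *(6) by fastforce
  then have T_eq: "{j. Min T \<le> j \<and> j \<le> c \<and> thr (\<tau> ! j) = thr (\<tau> ! i)} = T"
    using J(1) T(1) unfolding transactions_def by blast
  have "Max T = c" using J(2) unfolding T_eq .
  then show ?l using T c(4) by (auto simp: tx_aborted_def)
qed

text \<open>Whether an action is kept depends only on its own thread's past and future, and
  projecting to that thread preserves both. \<open>p\<close> collects the past and is therefore
  generalised in the induction.\<close>

lemma nths_context_proj:
  fixes s :: "('i, 't, 'r, 'p) action list"
  assumes "\<And>p a s. Q p (a # s) \<longleftrightarrow> Q (proj (thr a) p) (proj (thr a) (a # s))"
  shows "proj t (nths s {i. Q (p @ take i s) (drop i s)}) =
    nths (proj t s) {i. Q (proj t p @ take i (proj t s)) (drop i (proj t s))}"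
proof (induction s arbitrary: p)
  case Nil
  then show ?case by (simp add: proj_def)
next
  case (Cons a s)
  have pp: "proj t (proj t q) = proj t q" for q :: "('i, 't, 'r, 'p) action list"
    by (simp add: proj_def)
  have IH: "proj t (nths s {i. Q (p @ a # take i s) (drop i s)}) =
    nths (proj t s) {i. Q (proj t (p @ [a]) @ take i (proj t s)) (drop i (proj t s))}"
    using Cons.IH[of "p @ [a]"] by simp
  show ?case
  proof (cases "thr a = t")
    case True
    then have "Q p (a # s) \<longleftrightarrow> Q (proj t p) (a # proj t s)"
      using assms[of p a s] by (simp add: proj_def)
    moreover have "proj t (p @ [a]) = proj t p @ [a]" using True by (simp add: proj_def)
    ultimately show ?thesis using True IH
      by (simp add: nths_Cons proj_def)
  next
    case False
    then show ?thesis using IH by (simp add: nths_Cons proj_def)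
  qed
qed

text \<open>Being in an aborted transaction is decided by the thread's own past (a transaction is
  open, or begins here) and future (an abort completes it).\<close>

lemma proj_remove_aborted:
  fixes \<tau> :: "('i, 't, 'r, 'p) action list"
  shows "proj t (remove_aborted \<tau>) = remove_aborted (proj t \<tau>)"
proof -
  \<comment> \<open>\<open>Q\<close> describes the actions that are kept. The conjunct
    \<open>s \<noteq> []\<close> makes it true beyond the end of the list, where
    \<open>remove_aborted\<close> excludes no position either.\<close>
  define Q :: "('i, 't, 'r, 'p) action list \<Rightarrow> ('i, 't, 'r, 'p) action list \<Rightarrow> bool"
    where "Q p s \<longleftrightarrow> \<not> (s \<noteq> [] \<and> (in_tx (thr (hd s)) p \<or> akind (hd s) = Some BeginTx) \<and>
      aborts_next (thr (hd s)) s)" for p s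
  have *: "remove_aborted \<tau> = nths \<tau> {i. Q ([] @ take i \<tau>) (drop i \<tau>)}"
    for \<tau> :: "('i, 't, 'r, 'p) action list"
  proof -
    have "\<not> (\<exists>T\<in>transactions \<tau>. tx_aborted \<tau> T \<and> i \<in> T) \<longleftrightarrow> Q (take i \<tau>) (drop i \<tau>)" for i
    proof (cases "i < length \<tau>")
      case True
      then show ?thesis
        unfolding in_aborted_iff[OF True] transactional_iff[OF True] Q_def by (simp add: hd_drop_conv_nth)
    next
      case False
      then show ?thesis by (auto simp: Q_def transactions_def tx_segment_def)
    qed
    then show ?thesis by (simp add: remove_aborted_def)
  qed
  have "Q p (a # s) \<longleftrightarrow> Q (proj (thr a) p) (proj (thr a) (a # s))" for p a s
  proof -
    have "proj (thr a) (a # s) = a # proj (thr a) s" by (simp add: proj_def)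
    then show ?thesis
      using aborts_next_proj[of "thr a" "a # s"] by (simp add: Q_def in_tx_proj)
  qed
  from nths_context_proj[of Q, OF this, of t \<tau> "[]"] show ?thesis
    by (simp add: * proj_def)
qed

subsection \<open>Evaluation, thread by thread\<close>

text \<open>Actions of \<open>t\<close> read and write variables in \<open>LVar L t\<close> only, so
  a run can be replayed from any state that agrees there.\<close>

lemma eval_actions_cong_state:
  assumes "\<forall>\<alpha>\<in>set \<sigma>. thr \<alpha> = t" "\<forall>l\<in>LVar L t. s l = s1 l" "eval_actions L s \<sigma> \<noteq> {}"
  shows "eval_actions L s1 \<sigma> \<noteq> {}"
  using assms
proof (induction \<sigma> arbitrary: s s1)
  case (Cons \<alpha> \<sigma>)
  then obtain s' where s': "s' \<in> eval_action L \<alpha> s" "eval_actions L s' \<sigma> \<noteq> {}" by auto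
  \<comment> \<open>The replayed step takes the new values of the variables of \<open>t\<close> and
    leaves the rest of \<open>s1\<close> alone.\<close>
  define s1' where "s1' l = (if l \<in> LVar L t then s' l else s1 l)" for l
  have "restrict s (LVar L t) = restrict s1 (LVar L t)" "restrict s' (LVar L t) = restrict s1' (LVar L t)"
    using Cons.prems(2) by (auto simp: s1'_def restrict_def)
  then have "\<exists>s1'\<in>eval_action L \<alpha> s1. \<forall>l\<in>LVar L t. s' l = s1' l"
  proof (cases \<alpha>)
    case (IAct a u k)
    then show ?thesis using s'(1) Cons.prems(2) by auto
  next
    case (PAct a u c)
    then have "u = t" using Cons.prems(1) by simp
    then have "s1' \<in> eval_action L \<alpha> s1"
      using PAct s'(1) \<open>restrict s _ = _\<close> \<open>restrict s' _ = _\<close> by (auto simp: s1'_def)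
    moreover have "\<forall>l\<in>LVar L t. s' l = s1' l" by (simp add: s1'_def)
    ultimately show ?thesis by blast
  qed
  then obtain s2 where "s2 \<in> eval_action L \<alpha> s1" "\<forall>l\<in>LVar L t. s' l = s2 l" by blast
  then show ?case using Cons.IH[of s' s2] Cons.prems(1) s'(2) by auto
qed auto

lemma eval_action_other_thread:
  assumes "disjoint_family (LVar L)" "s' \<in> eval_action L \<alpha> s" "u \<noteq> thr \<alpha>"
  shows "\<forall>l\<in>LVar L u. s' l = s l"
  using assms by (cases \<alpha>) (auto simp: disjoint_family_on_def)

text \<open>Local variables are disjoint, so an action of one thread does not influence whether
  another thread's projection can run. Hence the choice of the intermediate state concerns the
  acting thread only.\<close>

lemma eval_actions_nonempty_iff_proj:
  assumes "disjoint_family (LVar L)"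
  shows "eval_actions L s \<sigma> \<noteq> {} \<longleftrightarrow> (\<forall>t. eval_actions L s (proj t \<sigma>) \<noteq> {})"
proof (induction \<sigma> arbitrary: s)
  case Nil
  then show ?case by (simp add: proj_def)
next
  case (Cons \<alpha> \<sigma>)
  have other: "eval_actions L s (proj u \<sigma>) \<noteq> {} \<longleftrightarrow> eval_actions L s' (proj u \<sigma>) \<noteq> {}"
    if "s' \<in> eval_action L \<alpha> s" "u \<noteq> thr \<alpha>" for s' u
    using eval_action_other_thread[OF assms that] eval_actions_cong_state[of "proj u \<sigma>" u L s s']
      eval_actions_cong_state[of "proj u \<sigma>" u L s' s] by (auto simp: proj_def)
  have projs: "proj t (\<alpha> # \<sigma>) = (if t = thr \<alpha> then \<alpha> # proj t \<sigma> else proj t \<sigma>)" for t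
    by (simp add: proj_def)
  have "eval_actions L s (\<alpha> # \<sigma>) \<noteq> {} \<longleftrightarrow>
    (\<exists>s'\<in>eval_action L \<alpha> s. \<forall>t. eval_actions L s' (proj t \<sigma>) \<noteq> {})"
    using Cons.IH by auto
  also have "\<dots> \<longleftrightarrow> (\<exists>s'\<in>eval_action L \<alpha> s. eval_actions L s' (proj (thr \<alpha>) \<sigma>) \<noteq> {} \<and>
      (\<forall>t. t \<noteq> thr \<alpha> \<longrightarrow> eval_actions L s (proj t \<sigma>) \<noteq> {}))"
    using other by metis
  also have "\<dots> \<longleftrightarrow> (\<forall>t. eval_actions L s (proj t (\<alpha> # \<sigma>)) \<noteq> {})"
    unfolding projs by auto
  finally show ?case .
qed

text \<open>\<open>eval\<close> recurses on \<open>butlast\<close> and so tests every prefix; a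
  transaction that aborts later is still checked in the prefixes where it has not yet
  aborted.\<close>

lemma eval_nonempty_iff:
  "eval L s \<tau> \<noteq> {} \<longleftrightarrow> (\<forall>\<pi>. prefix \<pi> \<tau> \<longrightarrow> eval_actions L s (remove_aborted \<pi>) \<noteq> {})"
proof (induction \<tau> rule: rev_induct)
  case Nil
  then show ?case by (subst eval.simps) (auto simp: remove_aborted_def)
next
  case (snoc \<alpha> \<tau>)
  have "eval L s (\<tau> @ [\<alpha>]) \<noteq> {} \<longleftrightarrow>
    eval L s \<tau> \<noteq> {} \<and> eval_actions L s (remove_aborted (\<tau> @ [\<alpha>])) \<noteq> {}"
    by (subst eval.simps) simp
  then show ?case unfolding snoc.IH by auto
qed

lemma prefix_filterE:
  assumes "prefix q (filter P xs)"
  obtains p where "prefix p xs" "filter P p = q"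
  using assms by (auto simp: prefix_def elim!: filter_eq_appendE)

text \<open>Prefixes of the two traces do not match each other as a whole. But each thread's
  projection of a prefix of \<open>\<tau>'\<close> is its projection of some prefix of
  \<open>\<tau>\<close>, possibly a different one for each thread.\<close>

lemma eval_nonempty_cong_proj:
  fixes \<tau> \<tau>' :: "('i, 't, 'r, 'l, 'c) trace"
  assumes disj: "disjoint_family (LVar L)" and proj: "\<And>t. proj t \<tau> = proj t \<tau>'"
    and ev: "eval L s \<tau> \<noteq> {}"
  shows "eval L s \<tau>' \<noteq> {}"
proof -
  have iff: "eval L s \<sigma> \<noteq> {} \<longleftrightarrow>
    (\<forall>\<pi> t. prefix \<pi> \<sigma> \<longrightarrow> eval_actions L s (remove_aborted (proj t \<pi>)) \<noteq> {})"
    for \<sigma> :: "('i, 't, 'r, 'l, 'c) trace"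
  proof -
    have "eval_actions L s (remove_aborted \<pi>) \<noteq> {} \<longleftrightarrow>
      (\<forall>t. eval_actions L s (remove_aborted (proj t \<pi>)) \<noteq> {})" for \<pi> :: "('i, 't, 'r, 'l, 'c) trace"
      using eval_actions_nonempty_iff_proj[OF disj, of s "remove_aborted \<pi>"]
      by (simp only: proj_remove_aborted)
    then show ?thesis unfolding eval_nonempty_iff by blast
  qed
  show ?thesis
    unfolding iff
  proof (intro allI impI)
    fix \<pi>' t
    assume "prefix \<pi>' \<tau>'"
    then have "prefix (proj t \<pi>') (proj t \<tau>)"
      unfolding proj by (auto simp: proj_def prefix_def)
    then obtain \<pi> where "prefix \<pi> \<tau>" "proj t \<pi> = proj t \<pi>'"
      unfolding proj_def by (rule prefix_filterE)
    then show "eval_actions L s (remove_aborted (proj t \<pi>')) \<noteq> {}"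
      using ev unfolding iff by metis
  qed
qed

subsection \<open>Non-transactional accesses\<close>

text \<open>As actions do not repeat, being transactional is a property of the action and of the
  interface actions of its thread, independently of its position.\<close>

definition tx_action :: "('i, 't, 'r, 'p) action list \<Rightarrow> ('i, 't, 'r, 'p) action \<Rightarrow> bool" where
  "tx_action h \<alpha> \<longleftrightarrow> akind \<alpha> = Some BeginTx \<or>
     in_tx (thr \<alpha>) (takeWhile (\<lambda>\<beta>. \<beta> \<noteq> \<alpha>) (proj (thr \<alpha>) h))"

lemma history_history: "history (history \<tau>) = history \<tau>"
  by (simp add: history_def)

lemma proj_history: "proj t (history \<tau>) = history (proj t \<tau>)"
  by (auto simp: proj_def history_def intro: filter_cong)

text \<open>Without repetitions, \<open>takeWhile\<close> up to the action recovers exactly its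
  thread's past, and restricting this past to interface actions does not affect
  \<open>in_tx\<close>. Free of positions, the right-hand side can be compared between rearranged
  sequences.\<close>

lemma transactional_iff_tx_action:
  assumes d: "distinct \<tau>" and i: "i < length \<tau>" and int: "is_interface (\<tau> ! i)"
  shows "transactional \<tau> i \<longleftrightarrow> tx_action (history \<tau>) (\<tau> ! i)"
proof -
  let ?\<alpha> = "\<tau> ! i" and ?t = "thr (\<tau> ! i)"
  have \<tau>: "\<tau> = take i \<tau> @ ?\<alpha> # drop (Suc i) \<tau>" using i by (rule id_take_nth_drop)
  have notin: "?\<alpha> \<notin> set (take i \<tau>)" using d \<tau> by (metis distinct_append not_distinct_conv_prefix)
  have "proj ?t (history \<tau>) =
      proj ?t (history (take i \<tau>)) @ ?\<alpha> # proj ?t (history (drop (Suc i) \<tau>))"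
    by (subst \<tau>) (simp add: proj_def history_def int)
  moreover have "?\<alpha> \<notin> set (proj ?t (history (take i \<tau>)))"
    using notin by (simp add: proj_def history_def)
  ultimately have "takeWhile (\<lambda>\<beta>. \<beta> \<noteq> ?\<alpha>) (proj ?t (history \<tau>)) = proj ?t (history (take i \<tau>))"
    by (auto simp: takeWhile_append)
  then show ?thesis
    unfolding tx_action_def transactional_iff[OF i] by (auto simp: in_tx_proj in_tx_history)
qed

lemma tx_action_cong:
  assumes "proj (thr \<alpha>) H = proj (thr \<alpha>) H'"
  shows "tx_action H \<alpha> = tx_action H' \<alpha>"
  using assms by (simp add: tx_action_def)

text \<open>The other requests are always transactional: \<open>BeginTx\<close> opens a transaction,
  and \<open>is_history\<close> demands it of \<open>TryCommit\<close>, at the position of the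
  action in the history.\<close>

lemma nontx_request_is_access:
  assumes hist: "is_history (history \<tau>)" and d: "distinct \<tau>" and i: "i < length \<tau>"
    and req: "is_request (\<tau> ! i)" and nt: "\<not> transactional \<tau> i"
  shows "is_access_request (\<tau> ! i)"
proof -
  have int: "is_interface (\<tau> ! i)" using req by (auto simp: is_request_def is_interface_def)
  have dh: "distinct (history \<tau>)" using d by (simp add: history_def)
  have "\<tau> ! i \<in> set (history \<tau>)" using int i by (simp add: history_def)
  then obtain j where j: "j < length (history \<tau>)" "history \<tau> ! j = \<tau> ! i"
    by (auto simp: in_set_conv_nth)
  have "\<not> transactional (history \<tau>) j"
    using nt j int transactional_iff_tx_action[OF d i int] transactional_iff_tx_action[OF dh j(1)]
    by (simp add: history_history)
  then have "akind (\<tau> ! i) \<noteq> Some TryCommit" using hist j unfolding is_history_def by metis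
  moreover have "akind (\<tau> ! i) \<noteq> Some BeginTx" using nt transactional_iff[OF i] by simp
  ultimately show ?thesis using req
    by (auto simp: is_request_def is_access_request_def elim!: request_kind.elims)
qed

text \<open>A transaction open at \<open>Suc i\<close> began at \<open>i\<close> or was already open
  there, so \<open>i\<close> would be transactional.\<close>

lemma transactional_Suc:
  assumes i: "Suc i < length \<tau>" and same: "thr (\<tau> ! Suc i) = thr (\<tau> ! i)"
    and nt: "\<not> transactional \<tau> i" and nb: "akind (\<tau> ! Suc i) \<noteq> Some BeginTx"
  shows "\<not> transactional \<tau> (Suc i)"
proof
  assume "transactional \<tau> (Suc i)"
  then obtain b where b: "b < Suc i" "thr (\<tau> ! b) = thr (\<tau> ! i)" "akind (\<tau> ! b) = Some BeginTx"
    "\<forall>j. b < j \<and> j < Suc i \<longrightarrow> thr (\<tau> ! j) = thr (\<tau> ! i) \<longrightarrow> \<not> is_completing (\<tau> ! j)"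
    using transactional_iff[OF i] nb in_tx_nth[of "Suc i" \<tau>] i same by auto
  then have "b = i \<or> in_tx (thr (\<tau> ! i)) (take i \<tau>)"
    using i in_tx_nth[of i \<tau>] by (metis Suc_lessD less_SucE less_SucI less_imp_le)
  then show False using transactional_iff[of i \<tau>] i nt b(3) by auto
qed

text \<open>A request completes nothing, so the transaction containing \<open>j\<close> is still
  open at \<open>i\<close>.\<close>

lemma transactional_after_request:
  assumes "j < i" "i < length \<tau>" "thr (\<tau> ! j) = thr (\<tau> ! i)" "is_request (\<tau> ! j)"
    and nc: "\<And>k. j < k \<Longrightarrow> k < i \<Longrightarrow> thr (\<tau> ! k) = thr (\<tau> ! i) \<Longrightarrow> \<not> is_completing (\<tau> ! k)"
    and tx: "transactional \<tau> j"
  shows "transactional \<tau> i"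
proof -
  have ncj: "\<not> is_completing (\<tau> ! j)"
    using assms(4) by (auto simp: is_completing_def is_request_def)
  have "\<exists>b\<le>j. thr (\<tau> ! b) = thr (\<tau> ! i) \<and> akind (\<tau> ! b) = Some BeginTx \<and>
      (\<forall>k. b < k \<and> k < j \<longrightarrow> thr (\<tau> ! k) = thr (\<tau> ! i) \<longrightarrow> \<not> is_completing (\<tau> ! k))"
    using tx transactional_iff[of j \<tau>] in_tx_nth[of j \<tau>] assms(1-3) by (auto dest: less_imp_le)
  then obtain b where b: "b \<le> j" "thr (\<tau> ! b) = thr (\<tau> ! i)" "akind (\<tau> ! b) = Some BeginTx"
      "\<And>k. b < k \<Longrightarrow> k < j \<Longrightarrow> thr (\<tau> ! k) = thr (\<tau> ! i) \<Longrightarrow> \<not> is_completing (\<tau> ! k)" by blast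
  have "\<not> is_completing (\<tau> ! k)" if "b < k" "k < i" "thr (\<tau> ! k) = thr (\<tau> ! i)" for k
    using b(4) nc ncj that by (cases k j rule: linorder_cases) auto
  then have "in_tx (thr (\<tau> ! i)) (take i \<tau>)"
    using b assms(1,2) by (subst in_tx_nth) (auto intro!: exI[of _ b])
  then show ?thesis using transactional_iff[of i \<tau>] assms(2) by simp
qed

text \<open>In the thread's history, requests sit at even and responses at odd indices, so a
  response has a predecessor there, which it matches; \<open>j\<close> is the position of that
  predecessor in \<open>\<tau>\<close>.\<close>

lemma history_response_preceded:
  assumes hist: "is_history (history \<tau>)" and i: "i < length \<tau>"
    and int: "is_interface (\<tau> ! i)" and nreq: "\<not> is_request (\<tau> ! i)"
  obtains j where "j < i" "matching (\<tau> ! j) (\<tau> ! i)"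
    "\<forall>k. j < k \<and> k < i \<and> thr (\<tau> ! k) = thr (\<tau> ! i) \<longrightarrow> \<not> is_interface (\<tau> ! k)"
proof -
  let ?P = "\<lambda>\<alpha>. is_interface \<alpha> \<and> thr \<alpha> = thr (\<tau> ! i)"
  define u where "u = filter ?P (take i \<tau>)"
  define h where "h = proj (thr (\<tau> ! i)) (history \<tau>)"
  have "h = filter ?P \<tau>" by (auto simp: h_def proj_def history_def intro: filter_cong)
  also have "\<dots> = u @ \<tau> ! i # filter ?P (drop (Suc i) \<tau>)"
    by (subst id_take_nth_drop[OF i]) (simp add: int u_def)
  finally have h: "h = u @ \<tau> ! i # filter ?P (drop (Suc i) \<tau>)" .
  then have nth: "length u < length h" "h ! length u = \<tau> ! i" by auto
  have "\<forall>n<length h. if even n then is_request (h ! n) else matching (h ! (n - 1)) (h ! n)"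
    using hist unfolding is_history_def Let_def h_def by blast
  from this[rule_format, OF nth(1)] have odd: "odd (length u)" and "matching (h ! (length u - 1)) (\<tau> ! i)"
    using nreq nth(2) by (auto split: if_splits)
  moreover from odd have ne: "u \<noteq> []" by auto
  ultimately have m: "matching (last u) (\<tau> ! i)" by (simp add: h nth_append last_conv_nth)
  \<comment> \<open>Splitting at the thread's last interface action before \<open>i\<close> locates
    \<open>last u\<close> in \<open>\<tau>\<close> and shows that no other one follows it before
    \<open>i\<close>.\<close>
  from ne have "\<exists>x\<in>set (take i \<tau>). ?P x" by (auto simp: u_def filter_empty_conv)
  from split_list_last_prop[OF this] obtain ys x zs where
    s: "take i \<tau> = ys @ x # zs" "?P x" "\<forall>z\<in>set zs. \<not> ?P z" by blast
  then have "filter ?P zs = []" by (auto simp: filter_empty_conv)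
  then have "u = filter ?P ys @ [x]" using s by (simp add: u_def)
  then have "last u = x" by simp
  have len: "length ys + Suc (length zs) = i" using arg_cong[OF s(1), of length] i by simp
  have nthk: "\<tau> ! k = (ys @ x # zs) ! k" if "k < i" for k using that s(1) by (metis nth_take)
  show ?thesis
  proof (rule that[of "length ys"])
    show "length ys < i" using len by simp
    then show "matching (\<tau> ! length ys) (\<tau> ! i)" using m \<open>last u = x\<close> nthk by simp
    have "\<not> is_interface (\<tau> ! k)"
      if k: "length ys < k" "k < i" "thr (\<tau> ! k) = thr (\<tau> ! i)" for k
    proof -
      have "\<tau> ! k = zs ! (k - Suc (length ys))" "k - Suc (length ys) < length zs"
        using nthk[OF k(2)] k len by (auto simp: nth_append nth_Cons')
      then show ?thesis using s(3) k(3) by (metis nth_mem)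
    qed
    then show "\<forall>k. length ys < k \<and> k < i \<and> thr (\<tau> ! k) = thr (\<tau> ! i) \<longrightarrow>
        \<not> is_interface (\<tau> ! k)" by blast
  qed
qed

lemma response_of_kinds:
  assumes "k' \<in> response_of k"
  shows "request_kind k \<and> \<not> request_kind k' \<and> k' \<noteq> BeginTx"
  using assms by (cases k) auto

lemma matching_simps:
  assumes "matching \<alpha> \<beta>"
  shows "is_request \<alpha>" "is_interface \<alpha>" "is_interface \<beta>" "\<not> is_request \<beta>" "thr \<alpha> = thr \<beta>"
    "akind \<beta> \<noteq> Some BeginTx"
  using assms
  by (auto simp: matching_def is_request_def is_interface_def dest: response_of_kinds)

text \<open>A non-transactional request forms an access with its immediate response. A
  non-transactional response leads back to its request, whose transaction, if any, would still be
  open at the response; so \<open>imm\<close> applies to the request and makes the two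
  adjacent.\<close>

lemma Union_nontx_accesses:
  assumes hist: "is_history (history \<tau>)" and d: "distinct \<tau>"
    and imm: "\<forall>i<length \<tau>. is_request (\<tau> ! i) \<and> \<not> transactional \<tau> i \<longrightarrow> response_at \<tau> i (Suc i)"
  shows "\<Union> (nontx_accesses \<tau>) = {i. i < length \<tau> \<and> is_interface (\<tau> ! i) \<and> \<not> transactional \<tau> i}"
    (is "_ = ?N")
proof
  show "\<Union> (nontx_accesses \<tau>) \<subseteq> ?N"
    by (auto simp: nontx_accesses_def response_at_def dest: matching_simps)
  have pair: "{i, Suc i} \<in> nontx_accesses \<tau>"
    if i: "i < length \<tau>" and req: "is_request (\<tau> ! i)" and nt: "\<not> transactional \<tau> i" for i
  proof -
    have r: "response_at \<tau> i (Suc i)" using imm that by blast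
    then have len: "Suc i < length \<tau>" and m: "matching (\<tau> ! i) (\<tau> ! Suc i)"
      by (auto simp: response_at_def)
    have "\<not> transactional \<tau> (Suc i)"
      using transactional_Suc[OF len _ nt] matching_simps(5,6)[OF m] by simp
    then show ?thesis
      using r nt nontx_request_is_access[OF hist d i req nt] by (auto simp: nontx_accesses_def)
  qed
  show "?N \<subseteq> \<Union> (nontx_accesses \<tau>)"
  proof
    fix i assume "i \<in> ?N"
    then have i: "i < length \<tau>" "is_interface (\<tau> ! i)" "\<not> transactional \<tau> i" by auto
    show "i \<in> \<Union> (nontx_accesses \<tau>)"
    proof (cases "is_request (\<tau> ! i)")
      case True
      then show ?thesis using pair[OF i(1)] i(3) by blast
    next
      case False
      obtain j where j: "j < i" "matching (\<tau> ! j) (\<tau> ! i)"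
        "\<forall>k. j < k \<and> k < i \<and> thr (\<tau> ! k) = thr (\<tau> ! i) \<longrightarrow> \<not> is_interface (\<tau> ! k)"
        by (rule history_response_preceded[OF hist i(1,2) False])
      note mj = matching_simps[OF j(2)]
      have "\<not> is_completing (\<tau> ! k)" if "j < k" "k < i" "thr (\<tau> ! k) = thr (\<tau> ! i)" for k
        using j(3) that by (auto simp: is_interface_def is_completing_def)
      then have nt: "\<not> transactional \<tau> j"
        using transactional_after_request[OF j(1) i(1) mj(5,1)] i(3) by blast
      have jl: "j < length \<tau>" using j(1) i(1) by simp
      have "response_at \<tau> j (Suc j)" using imm jl mj(1) nt by blast
      then have "matching (\<tau> ! j) (\<tau> ! Suc j)" by (simp add: response_at_def)
      then have "is_interface (\<tau> ! Suc j)" "thr (\<tau> ! Suc j) = thr (\<tau> ! i)"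
        using mj(5) by (auto dest: matching_simps)
      \<comment> \<open>\<open>Suc j\<close> carries an interface action of the same thread, and
        none lies strictly between \<open>j\<close> and \<open>i\<close>.\<close>
      then have "\<not> Suc j < i" using j(3) by blast
      then have "i = Suc j" using j(1) by simp
      then show ?thesis using pair[OF jl mj(1) nt] by blast
    qed
  qed
qed

text \<open>Every non-transactional interface action belongs to an access, so the observed accesses
  are a function of the history alone.\<close>

lemma nontx_eq_filter:
  assumes hist: "is_history (history \<tau>)" and d: "distinct \<tau>"
    and imm: "\<forall>i<length \<tau>. is_request (\<tau> ! i) \<and> \<not> transactional \<tau> i \<longrightarrow> response_at \<tau> i (Suc i)"
  shows "nontx \<tau> = filter (\<lambda>\<alpha>. \<not> tx_action (history \<tau>) \<alpha>) (history \<tau>)"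
proof -
  have "\<Union> (nontx_accesses \<tau>) =
      {i. i < length \<tau> \<and> (is_interface (\<tau> ! i) \<and> \<not> tx_action (history \<tau>) (\<tau> ! i))}"
    unfolding Union_nontx_accesses[OF assms] using transactional_iff_tx_action[OF d] by blast
  then have "nontx \<tau> = filter (\<lambda>\<alpha>. is_interface \<alpha> \<and> \<not> tx_action (history \<tau>) \<alpha>) \<tau>"
    unfolding nontx_def filter_eq_nths by simp
  then show ?thesis by (simp add: history_def)
qed

section \<open>What correspondence preserves: thread projections and client accesses\<close>

text \<open>Actions of one thread are totally ordered by \<open>po\<close>, which
  \<open>\<theta>\<close> preserves.\<close>

lemma corresponds_proj:
  assumes "H \<sqsubseteq>\<^sub>H S"
  shows "proj t H = proj t S"
proof -
  obtain \<theta> where "bij_betw \<theta> {..<length H} {..<length S}" "\<forall>i<length H. H ! i = S ! \<theta> i"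
    "\<forall>i j. (i, j) \<in> po H \<union> cl H \<longrightarrow> \<theta> i < \<theta> j"
    using assms by (auto simp: corresponds_def)
  then show ?thesis unfolding proj_def
    by (intro filter_eq_of_order_preserving_bij[of \<theta>]) (auto simp: po_def)
qed

text \<open>The client order makes \<open>\<theta>\<close> monotone on non-transactional positions.
  Which actions these are depends on thread projections only, so \<open>H\<close> and
  \<open>S\<close> agree on it.\<close>

lemma corresponds_nontx:
  assumes cor: "H \<sqsubseteq>\<^sub>H S" and "distinct H" and int: "\<forall>\<alpha>\<in>set H. is_interface \<alpha>"
  shows "filter (\<lambda>\<alpha>. \<not> tx_action H \<alpha>) H = filter (\<lambda>\<alpha>. \<not> tx_action S \<alpha>) S"
proof -
  obtain \<theta> where \<theta>: "bij_betw \<theta> {..<length H} {..<length S}" "\<forall>i<length H. H ! i = S ! \<theta> i"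
    "\<forall>i j. (i, j) \<in> po H \<union> cl H \<longrightarrow> \<theta> i < \<theta> j"
    using cor by (auto simp: corresponds_def)
  have "history H = H" using int by (simp add: history_def)
  then have "tx_action H (H ! i) \<longleftrightarrow> transactional H i" if "i < length H" for i
    using transactional_iff_tx_action[OF assms(2) that] int that by simp
  then have eq: "filter (\<lambda>\<alpha>. \<not> tx_action H \<alpha>) H = filter (\<lambda>\<alpha>. \<not> tx_action H \<alpha>) S"
    using \<theta> by (intro filter_eq_of_order_preserving_bij[of \<theta>]) (auto simp: cl_def)
  have "tx_action H = tx_action S"
    using tx_action_cong corresponds_proj[OF cor] by blast
  with eq show ?thesis by simp
qed

subsection \<open>Rearranging a trace along a corresponding history\<close>

text \<open>Every primitive action is scheduled right before the next interface action of its thread, so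
  that nothing comes between a request and a response that follows it in \<open>S\<close>.\<close>

primrec merge :: "('i, 't::finite, 'r, 'p) action list \<Rightarrow> ('t \<Rightarrow> ('i, 't, 'r, 'p) action list) \<Rightarrow>
    ('i, 't, 'r, 'p) action list" where
  "merge [] l = concat (map l (SOME ts. distinct ts \<and> set ts = UNIV))"
| "merge (\<alpha> # S) l = takeWhile (\<lambda>\<beta>. \<not> is_interface \<beta>) (l (thr \<alpha>)) @ \<alpha> #
     merge S (l(thr \<alpha> := tl (dropWhile (\<lambda>\<beta>. \<not> is_interface \<beta>) (l (thr \<alpha>)))))"

lemma history_Cons_split:
  assumes "history xs = \<alpha> # ys"
  shows "xs = takeWhile (\<lambda>\<beta>. \<not> is_interface \<beta>) xs @ \<alpha> # tl (dropWhile (\<lambda>\<beta>. \<not> is_interface \<beta>) xs)"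
    and "history (tl (dropWhile (\<lambda>\<beta>. \<not> is_interface \<beta>) xs)) = ys"
proof -
  obtain u v where "xs = u @ \<alpha> # v" "\<forall>x\<in>set u. \<not> is_interface x" "is_interface \<alpha>" "ys = filter is_interface v"
    using assms by (auto simp: history_def filter_eq_Cons_iff)
  then show "xs = takeWhile (\<lambda>\<beta>. \<not> is_interface \<beta>) xs @ \<alpha> # tl (dropWhile (\<lambda>\<beta>. \<not> is_interface \<beta>) xs)"
    "history (tl (dropWhile (\<lambda>\<beta>. \<not> is_interface \<beta>) xs)) = ys"
    by (simp_all add: history_def)
qed

text \<open>\<open>l t\<close> holds what thread \<open>t\<close> still has to emit, and its
  interface actions are those of \<open>t\<close> left in \<open>S\<close>. The block emitted for
  the head of \<open>S\<close> is just what is taken off the front of its thread's list.\<close>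

lemma merge_correct:
  fixes S :: "('i, 't::finite, 'r, 'p) action list"
  assumes "\<And>t. \<forall>\<alpha>\<in>set (l t). thr \<alpha> = t" "\<And>t. history (l t) = proj t S"
    and "\<forall>\<alpha>\<in>set S. is_interface \<alpha>"
  shows "history (merge S l) = S \<and> (\<forall>t. proj t (merge S l) = l t)"
  using assms
proof (induction S arbitrary: l)
  case Nil
  \<comment> \<open>When \<open>S\<close> is exhausted only primitive actions are left; they are
    appended thread by thread, in some enumeration of the finitely many threads.\<close>
  define ts :: "'t list" where "ts = (SOME ts. distinct ts \<and> set ts = UNIV)"
  obtain us :: "'t list" where "set us = UNIV" "distinct us"
    using finite_distinct_list[OF finite_UNIV] by blast
  then have "\<exists>us :: 't list. distinct us \<and> set us = UNIV" by blast
  then have ts: "distinct ts \<and> set ts = UNIV" unfolding ts_def by (rule someI_ex)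
  have 1: "history (concat (map l us)) = []" for us
    using Nil(2) by (induction us) (auto simp: history_def proj_def)
  have own: "filter (\<lambda>\<alpha>. thr \<alpha> = t) (l u) = (if u = t then l u else [])" for t u
    using Nil(1)[of u] by (auto simp: filter_empty_conv)
  have "proj t (concat (map l us)) = (if t \<in> set us then l t else [])" if "distinct us" for t us
    using that by (induction us) (auto simp: proj_def own)
  then show ?case using 1 ts by (simp add: ts_def[symmetric])
next
  case (Cons \<alpha> S)
  let ?t = "thr \<alpha>"
  let ?ps = "takeWhile (\<lambda>\<beta>. \<not> is_interface \<beta>) (l ?t)"
  let ?rest = "tl (dropWhile (\<lambda>\<beta>. \<not> is_interface \<beta>) (l ?t))"
  have "history (l ?t) = \<alpha> # proj ?t S" using Cons.prems(2) by (simp add: proj_def)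
  note split = history_Cons_split[OF this]
  have own: "\<forall>\<beta>\<in>set (?ps @ \<alpha> # ?rest). thr \<beta> = ?t"
    using Cons.prems(1)[of ?t] split(1) by metis
  have "\<forall>\<beta>\<in>set ?rest. thr \<beta> = ?t" using own unfolding set_append list.set by blast
  then have own': "\<forall>\<beta>\<in>set ((l(?t := ?rest)) t). thr \<beta> = t" for t
    unfolding fun_upd_apply using Cons.prems(1) by presburger
  have proj': "history ((l(?t := ?rest)) t) = proj t S" for t
    using split(2) Cons.prems(2)[of t] by (simp add: proj_def)
  have "\<forall>\<alpha>\<in>set S. is_interface \<alpha>" using Cons.prems(3) by simp
  note IH = Cons.IH[OF own' proj' this]
  have "history ?ps = []" by (auto simp: history_def filter_empty_conv dest: set_takeWhileD)
  moreover have "history [\<alpha>] = [\<alpha>]" using Cons.prems(3) by (simp add: history_def)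
  moreover have "history (merge (\<alpha> # S) l) =
      history ?ps @ history [\<alpha>] @ history (merge S (l(?t := ?rest)))"
    by (simp add: history_def)
  ultimately have "history (merge (\<alpha> # S) l) = \<alpha> # S" using IH by simp
  moreover have "proj t (merge (\<alpha> # S) l) = l t" for t
  proof -
    have "proj t (merge (\<alpha> # S) l) = proj t ?ps @ proj t [\<alpha>] @ proj t (merge S (l(?t := ?rest)))"
      by (simp add: proj_def)
    then have m: "proj t (merge (\<alpha> # S) l) = proj t ?ps @ proj t [\<alpha>] @ (l(?t := ?rest)) t"
      using IH by simp
    have ps: "\<forall>\<beta>\<in>set ?ps. thr \<beta> = ?t" using own unfolding set_append by blast
    show ?thesis
    proof (cases "t = ?t")
      case True
      then have "proj t ?ps = ?ps" using ps unfolding proj_def by (intro filter_True) blast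
      then have "proj t (merge (\<alpha> # S) l) = ?ps @ \<alpha> # ?rest"
        unfolding m using True by (simp add: proj_def)
      also have "\<dots> = l t" unfolding True by (rule split(1)[symmetric])
      finally show ?thesis .
    next
      case False
      then have "proj t ?ps = []" using ps unfolding proj_def by (intro filter_False) blast
      then show ?thesis unfolding m using False by (simp add: proj_def)
    qed
  qed
  ultimately show ?case by blast
qed

text \<open>After a request, the next action in its thread's list is an interface action, so no
  primitive block is inserted before \<open>\<beta>\<close>.\<close>

lemma merge_adjacent:
  assumes "\<And>t. \<forall>\<alpha>\<in>set (l t). thr \<alpha> = t" "\<And>t. history (l t) = proj t S"
    and "\<And>t u \<beta> \<gamma> v. l t = u @ \<beta> # \<gamma> # v \<Longrightarrow> is_request \<beta> \<Longrightarrow> is_interface \<gamma>"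
    and "S = u @ \<alpha> # \<beta> # v" "is_request \<alpha>" "thr \<alpha> = thr \<beta>"
  shows "\<exists>u' v'. merge S l = u' @ \<alpha> # \<beta> # v'"
  using assms
proof (induction S arbitrary: l u)
  case Nil
  then show ?case by simp
next
  case (Cons \<sigma> S)
  let ?t = "thr \<sigma>"
  let ?ps = "takeWhile (\<lambda>\<beta>. \<not> is_interface \<beta>) (l ?t)"
  let ?rest = "tl (dropWhile (\<lambda>\<beta>. \<not> is_interface \<beta>) (l ?t))"
  have "history (l ?t) = \<sigma> # proj ?t S" using Cons.prems(2) by (simp add: proj_def)
  note split = history_Cons_split[OF this]
  show ?case
  proof (cases u)
    case Nil
    then have S: "\<sigma> = \<alpha>" "S = \<beta> # v" using Cons.prems(4) by auto
    then have "history ?rest = \<beta> # proj ?t v" using split(2) Cons.prems(6) by (simp add: proj_def)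
    \<comment> \<open>The remaining list still has \<open>\<beta>\<close> in its history, so it is
      not empty; its head follows a request and is therefore an interface action.\<close>
    then obtain \<gamma> w where w: "?rest = \<gamma> # w" by (cases ?rest) (auto simp: history_def)
    then have "l ?t = ?ps @ \<alpha> # \<gamma> # w" using split(1) S(1) by simp
    then have "is_interface \<gamma>" using Cons.prems(3,5) by blast
    then have "takeWhile (\<lambda>\<beta>. \<not> is_interface \<beta>) ?rest = []" using w by simp
    then show ?thesis using S Cons.prems(6) by auto
  next
    case u: (Cons \<sigma>' u0)
    have own: "\<forall>\<beta>\<in>set (?ps @ \<sigma> # ?rest). thr \<beta> = ?t"
      using Cons.prems(1)[of ?t] split(1) by metis
    have "\<forall>\<beta>\<in>set ?rest. thr \<beta> = ?t" using own unfolding set_append list.set by blast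
    then have own': "\<forall>\<beta>\<in>set ((l(?t := ?rest)) t). thr \<beta> = t" for t
      unfolding fun_upd_apply using Cons.prems(1) by presburger
    have proj': "history ((l(?t := ?rest)) t) = proj t S" for t
      using split(2) Cons.prems(2)[of t] by (simp add: proj_def)
    have S: "S = u0 @ \<alpha> # \<beta> # v" using u Cons.prems(4) by simp
    have "\<exists>u' v'. merge S (l(?t := ?rest)) = u' @ \<alpha> # \<beta> # v'"
    proof (rule Cons.IH[OF own' proj' _ S Cons.prems(5,6)])
      show "is_interface \<gamma>" if "(l(?t := ?rest)) t = u @ \<beta> # \<gamma> # v" "is_request \<beta>" for t u \<beta> \<gamma> v
      proof (cases "t = ?t")
        case True
        then have "l t = (?ps @ \<sigma> # u) @ \<beta> # \<gamma> # v" using that(1) split(1) by simp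
        then show ?thesis using Cons.prems(3) that(2) by blast
      next
        case False
        then show ?thesis using Cons.prems(3) that by simp
      qed
    qed
    then obtain u' v' where "merge S (l(?t := ?rest)) = u' @ \<alpha> # \<beta> # v'" by blast
    then have "merge (\<sigma> # S) l = (?ps @ \<sigma> # u') @ \<alpha> # \<beta> # v'" by simp
    then show ?thesis by blast
  qed
qed

text \<open>Occurrences of \<open>x\<close> can be counted in the projection to its own thread. This
  carries distinct identifiers and the set of actions over to the rearranged trace.\<close>

lemma mset_eq_of_proj:
  fixes \<tau> \<tau>' :: "('i, 't, 'r, 'p) action list"
  assumes "\<And>t. proj t \<tau> = proj t \<tau>'"
  shows "mset \<tau> = mset \<tau>'"
proof (rule multiset_eqI)
  fix x
  have "count_list \<sigma> x = count_list (proj (thr x) \<sigma>) x" for \<sigma> :: "('i, 't, 'r, 'p) action list"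
    by (induction \<sigma>) (auto simp: proj_def)
  then show "count (mset \<tau>) x = count (mset \<tau>') x" using assms unfolding count_mset by metis
qed

text \<open>Most trace conditions transfer through the projections, the multiset of actions or
  \<open>S\<close>. The delicate one is that non-transactional requests are answered immediately:
  this holds in the history \<open>S\<close>, and merging keeps such pairs adjacent.\<close>

lemma rearrange:
  fixes L :: "('t::finite, 'l, 'c) language" and \<tau> :: "('i, 't, 'r, 'l, 'c) trace"
  assumes wf: "wf_language L"
    and \<tau>: "\<tau> \<in> program_traces L P" "eval L s \<tau> \<noteq> {}"
    and cor: "history \<tau> \<sqsubseteq>\<^sub>H S" and S: "S \<in> H_atomic v_init"
  obtains \<tau>' where "\<tau>' \<in> program_sem L P (H_atomic v_init)" "history \<tau>' = S" "\<tau> \<sim> \<tau>'"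
proof -
  define \<tau>' where "\<tau>' = merge S (\<lambda>t. proj t \<tau>)"
  have tr: "is_trace L \<tau>" using \<tau>(1) by (simp add: program_traces_def)
  have hS: "is_history S" using S by (simp add: H_atomic_def)
  have projS: "history (proj t \<tau>) = proj t S" for t
    using corresponds_proj[OF cor] by (simp add: proj_history)
  have own: "\<forall>\<alpha>\<in>set (proj t \<tau>). thr \<alpha> = t" for t by (simp add: proj_def)
  have "history \<tau>' = S \<and> (\<forall>t. proj t \<tau>' = proj t \<tau>)"
    unfolding \<tau>'_def using hS own projS by (intro merge_correct) (auto simp: is_history_def)
  then have h: "history \<tau>' = S" and p: "\<And>t. proj t \<tau>' = proj t \<tau>" by auto
  have ms: "mset \<tau>' = mset \<tau>" using p by (rule mset_eq_of_proj)
  have dai: "distinct (map aid \<tau>)" using tr by (simp add: is_trace_def)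
  then have dai': "distinct (map aid \<tau>')" using ms by (metis mset_eq_imp_distinct_iff mset_map)
  then have d: "distinct \<tau>" "distinct \<tau>'" using dai by (simp_all add: distinct_map)
  have dS: "distinct S" using d(2) h by (auto simp: history_def)
  have st: "set \<tau>' = set \<tau>" using ms by (metis set_mset_mset)
  have imm: "response_at \<tau>' i (Suc i)"
    if i: "i < length \<tau>'" and req: "is_request (\<tau>' ! i)" and nt: "\<not> transactional \<tau>' i" for i
  proof -
    have int: "is_interface (\<tau>' ! i)" using req by (auto simp: is_request_def is_interface_def)
    then have "\<tau>' ! i \<in> set S" using i h by (auto simp: history_def)
    then obtain j where j: "j < length S" "S ! j = \<tau>' ! i" by (auto simp: in_set_conv_nth)
    have "\<not> transactional S j"
      using nt transactional_iff_tx_action[OF d(2) i int] transactional_iff_tx_action[OF dS j(1)] int j(2)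
      by (metis h history_history)
    moreover have "is_access_request (S ! j)"
      using nontx_request_is_access[OF _ d(2) i req nt] hS h j(2) by simp
    ultimately have "response_at S j (Suc j)" using hS j(1) unfolding is_history_def by blast
    then have Sj: "Suc j < length S" and m: "matching (\<tau>' ! i) (S ! Suc j)"
      using j(2) by (auto simp: response_at_def)
    have "S = take j S @ \<tau>' ! i # S ! Suc j # drop (Suc (Suc j)) S"
      using Sj j by (metis Cons_nth_drop_Suc id_take_nth_drop)
    moreover have "is_interface \<gamma>" if "proj t \<tau> = u @ \<beta> # \<gamma> # v" "is_request \<beta>" for t u \<beta> \<gamma> v
    proof -
      have "Suc (length u) < length (proj t \<tau>)" "proj t \<tau> ! length u = \<beta>" "proj t \<tau> ! Suc (length u) = \<gamma>"
        using that(1) by (simp_all add: nth_append)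
      then show ?thesis using tr that(2) unfolding is_trace_def by blast
    qed
    ultimately obtain u v where uv: "\<tau>' = u @ \<tau>' ! i # S ! Suc j # v"
      using merge_adjacent[of "\<lambda>t. proj t \<tau>" S "take j S" "\<tau>' ! i" "S ! Suc j" "drop (Suc (Suc j)) S"]
        own projS req matching_simps(5)[OF m] by (auto simp: \<tau>'_def)
    have "ys ! length u = \<alpha> \<and> ys ! Suc (length u) = \<beta> \<and> Suc (length u) < length ys"
      if "ys = u @ \<alpha> # \<beta> # v" for ys and \<alpha> \<beta> :: "('i, 't, 'r, ('l, 'c) pcmd) action"
      using that by (simp add: nth_append)
    from this[OF uv] have *: "\<tau>' ! length u = \<tau>' ! i" "\<tau>' ! Suc (length u) = S ! Suc j"
      "Suc (length u) < length \<tau>'" by blast+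
    \<comment> \<open>Actions do not repeat, so the split obtained from merging is at position
      \<open>i\<close>.\<close>
    then have "length u = i" using d(2) i by (metis Suc_lessD nth_eq_iff_index_eq)
    then have "\<tau>' ! Suc i = S ! Suc j" "Suc i < length \<tau>'" using * by blast+
    then show ?thesis using m by (auto simp: response_at_def)
  qed
  have trace': "is_trace L \<tau>'"
    using tr dai' st p h hS imm unfolding is_trace_def by simp
  obtain \<rho> where \<rho>: "prefix \<tau> \<rho>" "\<And>t. proj t \<rho> \<in> com_seqs L t (P t)"
    using \<tau>(1) by (auto simp: program_traces_def)
  \<comment> \<open>The actions of \<open>\<rho>\<close> that follow \<open>\<tau>\<close> also
    complete \<open>\<tau>'\<close> to an interleaving of the same thread sequences.\<close>
  then obtain r where r: "\<rho> = \<tau> @ r" by (auto simp: prefix_def)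
  have "proj t (\<tau>' @ r) = proj t \<rho>" for t using p by (simp add: r proj_def)
  then have "\<tau>' \<in> program_traces L P"
    using trace' \<rho>(2) by (auto simp: program_traces_def intro!: exI[of _ "\<tau>' @ r"])
  moreover have "eval L s \<tau>' \<noteq> {}"
    using eval_nonempty_cong_proj[of L \<tau> \<tau>' s] wf p \<tau>(2) by (simp add: wf_language_def)
  ultimately have "\<tau>' \<in> program_sem L P (H_atomic v_init)"
    using S h by (auto simp: program_sem_def)
  moreover have "nontx \<tau> = nontx \<tau>'"
  proof -
    have hist: "is_history (history \<tau>)" using tr by (simp add: is_trace_def)
    have "nontx \<tau> = filter (\<lambda>\<alpha>. \<not> tx_action (history \<tau>) \<alpha>) (history \<tau>)"
      using hist d(1) tr by (intro nontx_eq_filter) (simp_all add: is_trace_def)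
    also have "\<dots> = filter (\<lambda>\<alpha>. \<not> tx_action S \<alpha>) S"
      using cor d(1) by (intro corresponds_nontx) (auto simp: history_def)
    also have "\<dots> = nontx \<tau>'"
      using nontx_eq_filter[of \<tau>'] h hS d(2) imm by simp
    finally show ?thesis .
  qed
  ultimately show ?thesis using that h p by (auto simp: obs_equiv_def)
qed

theorem theorem10:
  fixes L :: "('t::finite, 'l, 'c) language"
    and v_init :: int
    and \<H> :: "('i, 't, 'r, ('l, 'c) pcmd) action list set"
    and P :: "('t, 'r, 'l, 'c) program"
  assumes "wf_language L"
    and "is_TM \<H>"
    and "privatization_safe_opaque v_init \<H>"
    and "wf_program L P"
    and "TDRF_program TYPE('i) L v_init P"
  shows "program_sem L P \<H> \<preceq> program_sem L P (H_atomic v_init)"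
  unfolding obs_refines_def
proof
  fix \<tau> assume "\<tau> \<in> program_sem L P \<H>"
  then obtain s where \<tau>: "\<tau> \<in> program_traces L P" "eval L s \<tau> \<noteq> {}" "history \<tau> \<in> \<H>"
    by (auto simp: program_sem_def)
  note rearrange = rearrange[OF assms(1) \<tau>(1,2)]
  have "CDRF v_init (history \<tau>)"
    unfolding CDRF_def using assms(5) by (auto simp: TDRF_program_def elim: rearrange)
  then obtain S where "S \<in> H_atomic v_init" "history \<tau> \<sqsubseteq>\<^sub>H S"
    using assms(3) \<tau>(3) by (auto simp: privatization_safe_opaque_def)
  then show "\<exists>\<tau>'\<in>program_sem L P (H_atomic v_init). \<tau> \<sim> \<tau>'"
    by (auto elim: rearrange)
qed

end
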